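(* Let $\alpha\in L^*/L$, $\tau\in\mathfrak{H}$ and $n\in\mathbb{N}$. Then for every $Z=(z,w,z')\in\mathcal{D}$, \[ \sum_{(a,b,d)\in\mathcal{H}_n}\Theta_{\alpha}\left(\tau,\left(\frac{az+b}{d},\frac{\sqrt{n}}{d}w,z'\right)\right)=\sum_{(a,b,d)\in\mathcal{H}_n}\Theta_{\alpha}\left(\tau,\left(z,\frac{\sqrt{n}}{d}w,\frac{az'+b}{d}\right)\right). \]
   Context: Let $m\ge 0$ be an integer and $S$ a positive definite even integral symmetric $m\times m$ matrix (when $m=0$, all terms involving $S$ are omitted). For a symmetric matrix $T$ write $T(x,y)={}^t x T y$ and $T[x]=T(x,x)$ (complex bilinear). Let $Q$ be the $(m+4)\times(m+4)$ symmetric matrix with $1$ in positions $(1,m+4),(m+4,1),(2,m+3),(m+3,2)$, the block $-S$ in rows/columns $3,\dots,m+2$, and $0$ elsewhere; so $Q[x]=2x_1x_{m+4}+2x_2x_{m+3}-S[(x_3,\dots,x_{m+2})]$. Put $L=\mathbb{Z}^{m+4}$, $L^*=Q^{-1}L$. Let $Q_1$ be the analogous $(m+2)\times(m+2)$ matrix, so that for $Z=(z,w,z')$ with $z,z'\in\mathbb{C}$, $w\in\mathbb{C}^m$, $Q_1[Z]=2zz'-S[w]$. Let $\mathfrak{H}$ be the upper half plane and $\mathcal{D}=\{(z,w,z')\in\mathfrak{H}\times\mathbb{C}^m\times\mathfrak{H}: Q_1[\mathrm{Im}Z]=2\,\mathrm{Im}(z)\mathrm{Im}(z')-S[\mathrm{Im}(w)]>0\}$.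 For $Z\in\mathcal{D}$ put $\widetilde Z={}^t(-Q_1[Z]/2,\,z,\,w,\,z',\,1)\in\mathbb{C}^{m+4}$. Let $e(x)=\exp(2\pi i x)$. For $\alpha\in L^*/L$, $\tau\in\mathfrak{H}$, $Z\in\mathcal{D}$, the Siegel theta function is \[\Theta_\alpha(\tau,Z)=\sum_{\lambda\in\alpha+L}e\left(i\,\mathrm{Im}(\tau)\frac{|Q(\lambda,\widetilde Z)|^2}{Q_1[\mathrm{Im}Z]}+\frac{\bar\tau}{2}Q[\lambda]\right).\] (Equivalently, $\Theta_\alpha(\tau,Z)=\sum_{\lambda\in\alpha+L}e(\tau q(\lambda_v)+\bar\tau q(\lambda_v^\perp))$ with $q=Q[\cdot]/2$, $v$ the real span of $\mathrm{Re}\widetilde Z,\mathrm{Im}\widetilde Z$ in $\mathbb{R}^{m+4}$, and $\lambda_v,\lambda_v^\perp$ the orthogonal projections to $v$ and its $Q$-orthogonal complement.) For $n\in\mathbb{N}$, $\mathcal{H}_n=\{(a,b,d)\in\mathbb{Z}^3: a,d>0,\ ad=n,\ 0\le b<d\}$. *)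

theory Defs
  imports "HOL-Analysis.Infinite_Sum" "Jordan_Normal_Form.Matrix"
begin

text \<open>The Gram matrices are integral, and are used as bilinear (not Hermitian) forms over
  the integers, the reals and the complex numbers.\<close>

definition bform :: "int mat \<Rightarrow> 'a::comm_ring_1 vec \<Rightarrow> 'a vec \<Rightarrow> 'a" where
  "bform T x y = x \<bullet> (map_mat of_int T *\<^sub>v y)"

definition qform :: "int mat \<Rightarrow> 'a::comm_ring_1 vec \<Rightarrow> 'a" where
  "qform T x = bform T x x"

definition positive_definite :: "int mat \<Rightarrow> bool" where
  "positive_definite T \<longleftrightarrow>
     (\<forall>x::real vec. x \<in> carrier_vec (dim_row T) \<longrightarrow> x \<noteq> 0\<^sub>v (dim_row T) \<longrightarrow> qform T x > 0)"

definition even_form :: "int mat \<Rightarrow> bool" where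
  "even_form T \<longleftrightarrow> (\<forall>x::int vec. x \<in> carrier_vec (dim_row T) \<longrightarrow> even (qform T x))"

text \<open>Bordering a \<open>k \<times> k\<close> matrix by a hyperbolic plane: entries \<open>1\<close> in the two corners off the
  main diagonal, \<open>T\<close> in the middle. Bordering \<open>-S\<close> once gives \<open>Q\<^sub>1\<close>, bordering it twice
  gives \<open>Q\<close>.\<close>

definition hyp_border :: "int mat \<Rightarrow> int mat" where
  "hyp_border T = (let k = dim_row T in
     mat (k + 2) (k + 2) (\<lambda>(i, j).
       if i = 0 \<and> j = k + 1 \<or> i = k + 1 \<and> j = 0 then 1
       else if 1 \<le> i \<and> i \<le> k \<and> 1 \<le> j \<and> j \<le> k then T $$ (i - 1, j - 1)
       else 0))"

definition Q1_mat :: "int mat \<Rightarrow> int mat" where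
  "Q1_mat S = hyp_border (- S)"

definition Q_mat :: "int mat \<Rightarrow> int mat" where
  "Q_mat S = hyp_border (Q1_mat S)"

definition triple :: "'a \<Rightarrow> 'a vec \<Rightarrow> 'a \<Rightarrow> 'a vec" where
  "triple a x b = vCons a (x @\<^sub>v vCons b vNil)"

text \<open>The lattice \<open>L = \<int>\<^sup>m\<^sup>+\<^sup>4\<close> inside \<open>\<real>\<^sup>m\<^sup>+\<^sup>4\<close>, and \<open>L\<^sup>* = Q\<^sup>-\<^sup>1 L\<close>, written as a
  preimage (see \<open>dual_L_eq_image\<close> below).\<close>

definition lattice_L :: "int mat \<Rightarrow> real vec set" where
  "lattice_L S = map_vec of_int ` carrier_vec (dim_row S + 4)"

definition dual_L :: "int mat \<Rightarrow> real vec set" where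
  "dual_L S = {x \<in> carrier_vec (dim_row S + 4). map_mat of_int (Q_mat S) *\<^sub>v x \<in> lattice_L S}"

text \<open>Elements of \<open>L\<^sup>*/L\<close> are the cosets themselves, as sets of vectors.\<close>

definition discriminant_group :: "int mat \<Rightarrow> real vec set set" where
  "discriminant_group S = (\<lambda>v. (\<lambda>l. v + l) ` lattice_L S) ` dual_L S"

definition domain_D :: "int mat \<Rightarrow> complex vec set" where
  "domain_D S = {triple z w z' | z w z'.
     Im z > 0 \<and> w \<in> carrier_vec (dim_row S) \<and> Im z' > 0 \<and>
     qform (Q1_mat S) (map_vec Im (triple z w z')) > 0}"

definition Z_lift :: "int mat \<Rightarrow> complex vec \<Rightarrow> complex vec" where
  "Z_lift S Z = triple (- qform (Q1_mat S) Z / 2) Z 1"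

definition e2pi :: "complex \<Rightarrow> complex" where
  "e2pi x = exp (2 * of_real pi * \<i> * x)"

definition Theta :: "int mat \<Rightarrow> real vec set \<Rightarrow> complex \<Rightarrow> complex vec \<Rightarrow> complex" where
  "Theta S \<alpha> \<tau> Z = (\<Sum>\<^sub>\<infinity>l\<in>\<alpha>.
     e2pi (\<i> * of_real (Im \<tau> * (cmod (bform (Q_mat S) (map_vec of_real l) (Z_lift S Z)))\<^sup>2
                         / qform (Q1_mat S) (map_vec Im Z))
        + cnj \<tau> / 2 * of_real (qform (Q_mat S) l)))"

definition Hecke :: "nat \<Rightarrow> (int \<times> int \<times> int) set" where
  "Hecke n = {(a, b, d). a > 0 \<and> d > 0 \<and> a * d = int n \<and> 0 \<le> b \<and> b < d}"

lemma dim_hyp_border [simp]: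
  "dim_row (hyp_border T) = dim_row T + 2" "dim_col (hyp_border T) = dim_row T + 2"
  by (simp_all add: hyp_border_def Let_def)

lemma Q_carrier: "Q_mat S \<in> carrier_mat (dim_row S + 4) (dim_row S + 4)"
  by (rule carrier_matI) (simp_all add: Q_mat_def Q1_mat_def)

lemma dual_L_eq_image:
  assumes P: "P \<in> carrier_mat (dim_row S + 4) (dim_row S + 4)"
    and QP: "map_mat of_int (Q_mat S) * P = 1\<^sub>m (dim_row S + 4)"
    and PQ: "P * map_mat of_int (Q_mat S) = 1\<^sub>m (dim_row S + 4)"
  shows "dual_L S = (\<lambda>l. P *\<^sub>v l) ` lattice_L S"
proof -
  let ?n = "dim_row S + 4"
  let ?Q = "map_mat of_int (Q_mat S) :: real mat"
  have Q: "?Q \<in> carrier_mat ?n ?n" using Q_carrier by auto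
  have inv1: "P *\<^sub>v (?Q *\<^sub>v x) = x" if "x \<in> carrier_vec ?n" for x
    using assoc_mult_mat_vec[OF P Q that] PQ that by simp
  have inv2: "?Q *\<^sub>v (P *\<^sub>v x) = x" if "x \<in> carrier_vec ?n" for x
    using assoc_mult_mat_vec[OF Q P that] QP that by simp
  have L: "lattice_L S \<subseteq> carrier_vec ?n" by (auto simp: lattice_L_def)
  have Pc: "P *\<^sub>v x \<in> carrier_vec ?n" if "x \<in> carrier_vec ?n" for x
    using P that by (rule mult_mat_vec_carrier)
  show ?thesis
  proof (intro equalityI subsetI)
    fix x assume "x \<in> dual_L S"
    then have "x \<in> carrier_vec ?n" "?Q *\<^sub>v x \<in> lattice_L S"
      by (auto simp: dual_L_def)
    then show "x \<in> (\<lambda>l. P *\<^sub>v l) ` lattice_L S"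
      using inv1[of x] by (metis image_eqI)
  next
    fix x assume "x \<in> (\<lambda>l. P *\<^sub>v l) ` lattice_L S"
    then obtain l where "l \<in> lattice_L S" "x = P *\<^sub>v l" by blast
    then show "x \<in> dual_L S"
      using L inv2[of l] Pc[of l] by (auto simp: dual_L_def)
  qed
qed

lemma qform_hyp_border:
  fixes x :: "'a::comm_ring_1 vec"
  assumes T: "T \<in> carrier_mat k k" and x: "x \<in> carrier_vec k"
  shows "qform (hyp_border T) (triple a x b) = 2 * a * b + qform T x"
proof -
  have expand: "qform M v = (\<Sum>i<n. \<Sum>j<n. v $ i * (of_int (M $$ (i, j)) * v $ j))"
    if "M \<in> carrier_mat n n" "v \<in> carrier_vec n" for M and v :: "'a vec" and n
    using that by (auto simp: qform_def bform_def scalar_prod_def row_def sum_distrib_left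
        atLeast0LessThan intro!: sum.cong)
  let ?v = "triple a x b"
  have dim: "hyp_border T \<in> carrier_mat (Suc (Suc k)) (Suc (Suc k))"
    using T by (auto intro: carrier_matI)
  have v: "?v \<in> carrier_vec (Suc (Suc k))"
    using x by (auto simp: triple_def intro!: carrier_vecI)
  have v0: "?v $ 0 = a" by (simp add: triple_def)
  have vi: "?v $ Suc i = x $ i" if "i < k" for i
    using x that by (simp add: triple_def)
  have vk: "?v $ Suc k = b"
    using x by (simp add: triple_def)
  have M: "hyp_border T $$ (i, j) =
      (if i = 0 \<and> j = k + 1 \<or> i = k + 1 \<and> j = 0 then 1
       else if 1 \<le> i \<and> i \<le> k \<and> 1 \<le> j \<and> j \<le> k then T $$ (i - 1, j - 1) else 0)"
    if "i < Suc (Suc k)" "j < Suc (Suc k)" for i j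
    using T that by (simp add: hyp_border_def Let_def)
  have split: "(\<Sum>i<Suc (Suc k). f i) = f 0 + (\<Sum>i<k. f (Suc i)) + f (Suc k)" for f :: "nat \<Rightarrow> 'a"
    unfolding sum.lessThan_Suc[of f "Suc k"] sum.lessThan_Suc_shift[of f k] by simp
  have "qform (hyp_border T) ?v = 2 * a * b + (\<Sum>i<k. \<Sum>j<k. x $ i * (of_int (T $$ (i, j)) * x $ j))"
    unfolding expand[OF dim v] split by (simp add: M v0 vi vk algebra_simps)
  then show ?thesis using expand[OF T x] by simp
qed

lemma qform_uminus:
  fixes x :: "'a::comm_ring_1 vec"
  assumes "T \<in> carrier_mat k k" "x \<in> carrier_vec k"
  shows "qform (- T) x = - qform T x"
  using assms by (auto simp: qform_def bform_def scalar_prod_def row_def sum_distrib_left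
      sum_negf[symmetric] intro!: sum.cong)

lemma qform_Q1:
  fixes w :: "'a::comm_ring_1 vec"
  assumes "S \<in> carrier_mat m m" "w \<in> carrier_vec m"
  shows "qform (Q1_mat S) (triple z w z') = 2 * z * z' - qform S w"
  using assms by (simp add: Q1_mat_def qform_hyp_border qform_uminus)

lemma qform_Q:
  fixes x :: "'a::comm_ring_1 vec"
  assumes S: "S \<in> carrier_mat m m" and x: "x \<in> carrier_vec m"
  shows "qform (Q_mat S) (triple a (triple b x c) d) = 2 * a * d + 2 * b * c - qform S x"
proof -
  have "Q1_mat S \<in> carrier_mat (m + 2) (m + 2)" 
    using S by (auto simp: Q1_mat_def intro: carrier_matI)
  moreover have "triple b x c \<in> carrier_vec (m + 2)"
    using x by (auto simp: triple_def intro!: carrier_vecI)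
  ultimately show ?thesis
    using qform_Q1[OF S x] by (simp add: Q_mat_def qform_hyp_border)
qed

end

theory Submission
  imports Defs "Jordan_Normal_Form.Determinant"
begin

text \<open>Let \<open>F\<close> be the summand of the theta series at \<open>Z\<close>, evaluated at \<open>(y / \<surd>n, x)\<close> with
  \<open>y = (y\<^sub>1, y\<^sub>2, y\<^sub>3, y\<^sub>4)\<close> in the two hyperbolic planes and \<open>x\<close> in the \<open>S\<close>-block. The summand at the
  translate of \<open>Z\<close> by \<open>(a, b, d)\<close> is \<open>F\<close> at the image of a lattice vector under an injective integral
  map. Hence both sides are sums of \<open>F\<close>, weighted by the number of \<open>(a, b, d)\<close> whose image contains
  \<open>y\<close>. On the left this is the number of sublattices of index \<open>n\<close> in \<open>\<int>\<^sup>2\<close> containing the columns of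
  the matrix with rows \<open>(y\<^sub>1, y\<^sub>2)\<close>, \<open>(y\<^sub>3, -y\<^sub>4)\<close>, on the right the same number for its transpose. The
  two agree because the count is invariant under unimodular row and column operations. Absolute
  convergence, needed for the rearrangement, follows from positive definiteness of the majorant.\<close>

subsection \<open>Lattices of index \<open>n\<close> in the plane\<close>

text \<open>The column span of the Hermite normal form with rows (d, b) and (0, a). For
  \<open>(a, b, d)\<close> in \<open>Hecke n\<close> its index in Z^2 is a * d = n.\<close>

definition hecke_lattice :: "int \<times> int \<times> int \<Rightarrow> (int \<times> int) set" where
  "hecke_lattice = (\<lambda>(a, b, d). {(d * u + b * v, a * v) | u v. True})"

lemma hecke_lattice_iff: "P \<in> hecke_lattice (a, b, d) \<longleftrightarrow> (\<exists>u v. P = (d * u + b * v, a * v))"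
  by (simp add: hecke_lattice_def)

lemma mem_hecke_lattice:
  assumes "a \<noteq> 0"
  shows "(x, y) \<in> hecke_lattice (a, b, d) \<longleftrightarrow> a dvd y \<and> d dvd x - b * (y div a)"
proof
  assume "(x, y) \<in> hecke_lattice (a, b, d)"
  then show "a dvd y \<and> d dvd x - b * (y div a)"
    using assms by (auto simp: hecke_lattice_def)
next
  assume "a dvd y \<and> d dvd x - b * (y div a)"
  then obtain v u where "y = a * v" "x - b * (y div a) = d * u" unfolding dvd_def by blast
  then have "x = d * u + b * v" "y = a * v" using assms by auto
  then show "(x, y) \<in> hecke_lattice (a, b, d)"
    unfolding hecke_lattice_iff by blast
qed

lemma hecke_lattice_add:
  assumes "P \<in> hecke_lattice h" "R \<in> hecke_lattice h"
  shows "(fst P + k * fst R, snd P + k * snd R) \<in> hecke_lattice h"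
proof -
  obtain a b d where h: "h = (a, b, d)" by (cases h) auto
  obtain u v u' v' where "P = (d * u + b * v, a * v)" "R = (d * u' + b * v', a * v')"
    using assms by (auto simp: h hecke_lattice_def)
  then have "(fst P + k * fst R, snd P + k * snd R) =
      (d * (u + k * u') + b * (v + k * v'), a * (v + k * v'))"
    by (simp add: algebra_simps)
  then show ?thesis unfolding h hecke_lattice_iff by blast
qed

text \<open>Uniqueness of the Hermite normal form: a is the positive generator of the second
  coordinates, d is then fixed by a * d = n, and b modulo d is fixed by the points at height
  a.\<close>

lemma inj_on_hecke_lattice: "inj_on hecke_lattice (Hecke n)"
proof (rule inj_onI)
  fix h h' assume hs: "h \<in> Hecke n" "h' \<in> Hecke n" and eq: "hecke_lattice h = hecke_lattice h'"
  obtain a b d where h: "h = (a, b, d)" by (cases h) auto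
  obtain a' b' d' where h': "h' = (a', b', d')" by (cases h') auto
  have 1: "a > 0" "d > 0" "a * d = int n" "0 \<le> b" "b < d"
    and 2: "a' > 0" "d' > 0" "a' * d' = int n" "0 \<le> b'" "b' < d'"
    using hs by (auto simp: h h' Hecke_def)
  have "(b, a) \<in> hecke_lattice h" "(b', a') \<in> hecke_lattice h'"
    using 1 2 by (simp_all add: h h' mem_hecke_lattice)
  then have m: "(b, a) \<in> hecke_lattice h'" "(b', a') \<in> hecke_lattice h" using eq by simp_all
  then have "a' dvd a" "a dvd a'" using 1 2 by (simp_all add: h h' mem_hecke_lattice)
  then have aa: "a = a'" using 1 2 by (intro zdvd_antisym_nonneg) simp_all
  then have dd: "d = d'" using 1 2 by (metis mult_cancel_left order_less_irrefl)
  have "d' dvd b - b'" using m(1) aa 1 by (simp add: h' mem_hecke_lattice)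
  then have "b = b'" using 1 2 dd by (metis mod_eq_dvd_iff mod_pos_pos_trivial)
  then show "h = h'" using aa dd by (simp add: h h')
qed

text \<open>The shear fixes (d, 0) and sends (b, a) to (b + k * a, a), so only the entry b of the
  normal form changes, up to reduction modulo d.\<close>

lemma hecke_lattice_shear:
  assumes "h \<in> Hecke n"
  shows "\<exists>h'\<in>Hecke n. (\<lambda>(x, y). (x + k * y, y)) ` hecke_lattice h = hecke_lattice h'"
proof -
  obtain a b d where h: "h = (a, b, d)" by (cases h) auto
  have 1: "a > 0" "d > 0" "a * d = int n" "0 \<le> b" "b < d"
    using assms by (auto simp: h Hecke_def)
  let ?b = "(b + k * a) mod d"
  have mem: "(a, ?b, d) \<in> Hecke n" using 1 by (simp add: Hecke_def)
  have iff: "(x + k * y, y) \<in> hecke_lattice (a, ?b, d) \<longleftrightarrow> (x, y) \<in> hecke_lattice h" for x y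
  proof (cases "a dvd y")
    case True
    then obtain v where y: "y = a * v" by (auto simp: dvd_def)
    \<comment> \<open>With a free \<open>c\<close> in place of the remainder \<open>?b\<close> this
      is a polynomial identity; \<open>mod\<close> enters only through the division
      equation.\<close>
    have gen: "(x + k * (a * v)) - c * v = (x - b * v) + d * (q * v)"
      if "c = b + k * a - d * q" for c q
      unfolding that by (simp add: algebra_simps)
    have "(x + k * (a * v)) - ?b * v = (x - b * v) + d * ((b + k * a) div d * v)"
      by (rule gen) (rule minus_mult_div_eq_mod[symmetric])
    then have "d dvd (x + k * (a * v)) - ?b * v \<longleftrightarrow> d dvd x - b * v"
      by (metis dvd_add_left_iff dvd_triv_left)
    then show ?thesis using 1 by (simp add: h mem_hecke_lattice y)
  qed (use 1 in \<open>simp add: h mem_hecke_lattice\<close>)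
  have "(\<lambda>(x, y). (x + k * y, y)) ` hecke_lattice h = hecke_lattice (a, ?b, d)"
  proof (intro equalityI subsetI)
    fix P assume "P \<in> hecke_lattice (a, ?b, d)"
    moreover obtain x y where P: "P = (x, y)" by (cases P)
    ultimately have "(x - k * y, y) \<in> hecke_lattice h" using iff[of "x - k * y" y] by simp
    then show "P \<in> (\<lambda>(x, y). (x + k * y, y)) ` hecke_lattice h"
      by (force simp: P intro!: image_eqI[of _ _ "(x - k * y, y)"])
  qed (auto simp: iff)
  then show ?thesis using mem by blast
qed

text \<open>The swapped lattice is spanned by (0, d) and (a, b). Its second coordinates are the
  multiples of g = gcd b d. The Bezout coefficients give the vector (a * u, g), and d1 * (a, b) - b1
  * (0, d) = (a * d1, 0) is the horizontal generator. Reducing a * u modulo a * d1 yields the normal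
  form.\<close>

lemma hecke_lattice_swap:
  assumes "h \<in> Hecke n"
  shows "\<exists>h'\<in>Hecke n. prod.swap ` hecke_lattice h = hecke_lattice h'"
proof -
  obtain a b d where h: "h = (a, b, d)" by (cases h) auto
  have 1: "a > 0" "d > 0" "a * d = int n" "0 \<le> b" "b < d"
    using assms by (auto simp: h Hecke_def)
  define g where "g = gcd b d"
  obtain u v where uv: "u * b + v * d = g" using bezout_int[of b d] by (auto simp: g_def)
  obtain b1 d1 where b1: "b = g * b1" and d1: "d = g * d1"
    using gcd_dvd1[of b d] gcd_dvd2[of b d] unfolding g_def dvd_def by blast
  have g: "g > 0" using 1 by (simp add: g_def)
  have d1p: "d1 > 0" using 1 g d1 by (simp add: zero_less_mult_iff)
  have "g * (u * b1 + v * d1) = g * 1" using uv b1 d1 by (simp add: algebra_simps)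
  then have one: "u * b1 + v * d1 = 1" using g by (metis mult_cancel_left order_less_irrefl)
  let ?b = "(a * u) mod (a * d1)" and ?q = "(a * u) div (a * d1)"
  have qb: "a * u = a * d1 * ?q + ?b" by (rule mult_div_mod_eq[symmetric])
  have mem: "(g, ?b, a * d1) \<in> Hecke n" using 1 g d1p by (simp add: Hecke_def d1 algebra_simps)
  have "prod.swap ` hecke_lattice h = hecke_lattice (g, ?b, a * d1)"
  proof (intro equalityI subsetI)
    fix P assume "P \<in> prod.swap ` hecke_lattice h"
    then obtain R where R: "R \<in> hecke_lattice h" "P = prod.swap R" by (rule imageE)
    from R(1) obtain s t where "R = (d * s + b * t, a * t)" unfolding h hecke_lattice_iff by blast
    then have P: "P = (a * t, d * s + b * t)" using R(2) by simp
    have P2: "d * s + b * t = g * (d1 * s + b1 * t)" by (simp add: b1 d1 algebra_simps)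
    have "a * t - a * u * (d1 * s + b1 * t) = a * d1 * (v * t - u * s)"
      using arg_cong[OF one, of "\<lambda>x. a * t * x"] by (simp add: algebra_simps)
    moreover have "a * t - r * X = a * d1 * Y + a * d1 * k * X"
      if "a * t - a * u * X = a * d1 * Y" "a * u = a * d1 * k + r" for r k X Y
      using that(1) unfolding that(2) by (simp add: algebra_simps)
    ultimately have "a * t - ?b * (d1 * s + b1 * t) =
        a * d1 * (v * t - u * s) + a * d1 * ?q * (d1 * s + b1 * t)"
      using qb by blast
    then have "a * d1 dvd a * t - ?b * (d1 * s + b1 * t)"
      by (metis dvd_add dvd_triv_left mult.assoc)
    then show "P \<in> hecke_lattice (g, ?b, a * d1)" using g by (simp add: P P2 mem_hecke_lattice)
  next
    fix P assume "P \<in> hecke_lattice (g, ?b, a * d1)"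
    then obtain s t where P: "P = (a * d1 * s + ?b * t, g * t)" by (auto simp: hecke_lattice_def)
    \<comment> \<open>\<open>?T\<close> and \<open>?S\<close> are the coefficients of (a, b) and (0,
      d). They result from writing (\<open>?b\<close>, g) as (a * u, g) - \<open>?q\<close> * (a *
      d1, 0) and expressing both vectors on the right in these generators.\<close>
    let ?T = "d1 * (s - ?q * t) + u * t" and ?S = "v * t - b1 * (s - ?q * t)"
    have "a * d1 * s + r * t = a * (d1 * (s - k * t) + u * t)" if "a * u = a * d1 * k + r" for k r
      using arg_cong[OF that, of "\<lambda>x. x * t"] by (simp add: algebra_simps)
    from this[OF qb] have "a * d1 * s + ?b * t = a * ?T" .
    moreover have "g * t = d * ?S + b * ?T"
      using arg_cong[OF one, of "\<lambda>x. g * t * x"] by (simp add: b1 d1 algebra_simps)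
    ultimately have "P = prod.swap (d * ?S + b * ?T, a * ?T)" by (simp add: P)
    moreover have "(d * ?S + b * ?T, a * ?T) \<in> hecke_lattice h" unfolding h hecke_lattice_iff by blast
    ultimately show "P \<in> prod.swap ` hecke_lattice h" by (rule image_eqI)
  qed
  then show ?thesis using mem by blast
qed

section \<open>Counting the lattices that contain two given points\<close>

definition lattice_count :: "nat \<Rightarrow> int \<Rightarrow> int \<Rightarrow> int \<Rightarrow> int \<Rightarrow> nat" where
  "lattice_count n p q r s = card {\<Gamma> \<in> hecke_lattice ` Hecke n. (p, r) \<in> \<Gamma> \<and> (q, s) \<in> \<Gamma>}"

text \<open>Passes from triples to the lattices themselves, on which automorphisms of Z^2 act
  directly; the arguments of \<open>lattice_count\<close> are the entries of a 2 x 2 matrix, read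
  row by row.\<close>

lemma card_hecke_eq_lattice_count:
  "card {h \<in> Hecke n. (p, r) \<in> hecke_lattice h \<and> (q, s) \<in> hecke_lattice h} = lattice_count n p q r s"
proof -
  have "{\<Gamma> \<in> hecke_lattice ` Hecke n. (p, r) \<in> \<Gamma> \<and> (q, s) \<in> \<Gamma>} =
      hecke_lattice ` {h \<in> Hecke n. (p, r) \<in> hecke_lattice h \<and> (q, s) \<in> hecke_lattice h}" by auto
  then show ?thesis unfolding lattice_count_def
    by (metis (no_types, lifting) card_image inj_on_hecke_lattice inj_on_subset mem_Collect_eq subsetI)
qed

text \<open>An automorphism that preserves the family permutes its members, and \<open>V\<close>
  carries the lattices through \<open>U P\<close> and \<open>U R\<close> to those through
  \<open>P\<close> and \<open>R\<close>. Applied to swaps and shears of the plane, this is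
  invariance under row operations.\<close>

lemma card_lattices_map:
  fixes U V :: "int \<times> int \<Rightarrow> int \<times> int"
  assumes VU: "\<And>x. V (U x) = x" and UV: "\<And>x. U (V x) = x"
    and U: "\<And>\<Gamma>. \<Gamma> \<in> \<L> \<Longrightarrow> U ` \<Gamma> \<in> \<L>" and V: "\<And>\<Gamma>. \<Gamma> \<in> \<L> \<Longrightarrow> V ` \<Gamma> \<in> \<L>"
  shows "card {\<Gamma> \<in> \<L>. U P \<in> \<Gamma> \<and> U R \<in> \<Gamma>} = card {\<Gamma> \<in> \<L>. P \<in> \<Gamma> \<and> R \<in> \<Gamma>}"
proof (rule bij_betw_same_card)
  have "V ` U ` \<Gamma> = \<Gamma>" "U ` V ` \<Gamma> = \<Gamma>" for \<Gamma> by (simp_all add: image_image VU UV)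
  then show "bij_betw ((`) V) {\<Gamma> \<in> \<L>. U P \<in> \<Gamma> \<and> U R \<in> \<Gamma>} {\<Gamma> \<in> \<L>. P \<in> \<Gamma> \<and> R \<in> \<Gamma>}"
    using U V by (intro bij_betwI[where g = "(`) U"]) (auto intro: image_eqI[of _ V "U _"] simp: VU)
qed

lemma lattice_count_swap_cols: "lattice_count n q p s r = lattice_count n p q r s"
  unfolding lattice_count_def by (metis (lifting))

text \<open>A column operation does not even change the set that is counted: a lattice containing
  the first column contains the second column exactly when it contains the sheared one.\<close>

lemma lattice_count_shear_cols: "lattice_count n p (q + k * p) r (s + k * r) = lattice_count n p q r s"
proof -
  have "(q + k * p, s + k * r) \<in> hecke_lattice h \<longleftrightarrow> (q, s) \<in> hecke_lattice h"
    if "(p, r) \<in> hecke_lattice h" for h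
    using hecke_lattice_add[OF _ that, of "(q, s)" k]
      hecke_lattice_add[OF _ that, of "(q + k * p, s + k * r)" "- k"] by auto
  then have "{\<Gamma> \<in> hecke_lattice ` Hecke n. (p, r) \<in> \<Gamma> \<and> (q + k * p, s + k * r) \<in> \<Gamma>} =
    {\<Gamma> \<in> hecke_lattice ` Hecke n. (p, r) \<in> \<Gamma> \<and> (q, s) \<in> \<Gamma>}" by blast
  then show ?thesis unfolding lattice_count_def by simp
qed

lemma lattice_count_swap_rows: "lattice_count n r s p q = lattice_count n p q r s"
  unfolding lattice_count_def
  using card_lattices_map[of prod.swap prod.swap "hecke_lattice ` Hecke n" "(p, r)" "(q, s)"]
    hecke_lattice_swap[of _ n] by fastforce

lemma lattice_count_shear_top: "lattice_count n (p + k * r) (q + k * s) r s = lattice_count n p q r s"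
  unfolding lattice_count_def
  using card_lattices_map[of "\<lambda>(x, y). (x + - k * y, y)" "\<lambda>(x, y). (x + k * y, y)"
      "hecke_lattice ` Hecke n" "(p, r)" "(q, s)"]
    hecke_lattice_shear[of _ n k] hecke_lattice_shear[of _ n "- k"] by fastforce

lemma lattice_count_shear_rows: "lattice_count n p q (r + k * p) (s + k * q) = lattice_count n p q r s"
  by (metis lattice_count_swap_rows lattice_count_shear_top)

text \<open>Row and column operations reduce the matrix to a diagonal one, as in the Smith normal form; only
  the first Euclidean descent is needed, since a diagonal matrix is its own transpose.\<close>
lemma lattice_count_transpose: "lattice_count n p q r s = lattice_count n p r q s"
proof -
  have *: "p \<noteq> 0 \<Longrightarrow> lattice_count n p q r s = lattice_count n p r q s" for p q r s
  proof (induction "nat \<bar>p\<bar>" arbitrary: p q r s rule: less_induct)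
    case less
    show ?case
    proof (cases "p dvd q \<and> p dvd r")
      case True
      then obtain i j where "q = p * i" "r = p * j" by (auto simp: dvd_def)
      then have *: "q + - i * p = 0" "r + - j * p = 0" by simp_all
      have "lattice_count n p q r s = lattice_count n p 0 r (s + - i * r)"
        using lattice_count_shear_cols[of n p q "- i" r s] * by simp
      also have "\<dots> = lattice_count n p 0 0 (s + - i * r)"
        using lattice_count_shear_rows[of n p 0 r "- j" "s + - i * r"] * by simp
      also have "\<dots> = lattice_count n p r 0 (s + - i * r)"
        using lattice_count_shear_cols[of n p r "- j" 0 "s + - i * r"] * by simp
      also have "\<dots> = lattice_count n p r q s"
        using lattice_count_shear_rows[of n p r q "- i" s] * by simp
      finally show ?thesis .
    next
      case False
      \<comment> \<open>Euclidean division: the new entry is the remainder of \<open>q\<close>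
        modulo \<open>p\<close>, nonzero because \<open>p\<close> does not divide
        \<open>q\<close>.\<close>
      have reduce: "\<exists>k. q - k * p \<noteq> 0 \<and> nat \<bar>q - k * p\<bar> < nat \<bar>p\<bar>" if "\<not> p dvd q" for q
        using that less.prems abs_mod_less[of p q]
        by (intro exI[of _ "q div p"]) (auto simp: minus_div_mult_eq_mod mod_eq_0_iff_dvd)
      from False consider (q) "\<not> p dvd q" | (r) "\<not> p dvd r" by blast
      then show ?thesis
      proof cases
        case q
        then obtain k where k: "q - k * p \<noteq> 0" "nat \<bar>q - k * p\<bar> < nat \<bar>p\<bar>" using reduce by blast
        have "lattice_count n p q r s = lattice_count n (q - k * p) p (s - k * r) r"
          using lattice_count_shear_cols[of n p q "- k" r s] by (simp add: lattice_count_swap_cols)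
        \<comment> \<open>The induction hypothesis transposes the column-reduced matrix; the column
          operations that produced it become row operations on the transpose, which are undone
          next.\<close>
        also have "\<dots> = lattice_count n (q - k * p) (s - k * r) p r"
          using less.hyps[OF k(2) k(1)] .
        also have "\<dots> = lattice_count n p r q s"
          using lattice_count_shear_rows[of n p r "- k" q s]
          by (simp add: lattice_count_swap_rows lattice_count_shear_rows[of n p r q "- k" s, simplified])
        finally show ?thesis .
      next
        case r
        then obtain k where k: "r - k * p \<noteq> 0" "nat \<bar>r - k * p\<bar> < nat \<bar>p\<bar>" using reduce by blast
        have "lattice_count n p q r s = lattice_count n (r - k * p) (s - k * q) p q"
          using lattice_count_shear_rows[of n p q r "- k" s] by (simp add: lattice_count_swap_rows)
        also have "\<dots> = lattice_count n (r - k * p) p (s - k * q) q"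
          using less.hyps[OF k(2) k(1)] .
        also have "\<dots> = lattice_count n p r q s"
          using lattice_count_shear_cols[of n p r "- k" q s] by (simp add: lattice_count_swap_cols)
        finally show ?thesis .
      qed
    qed
  qed
  show ?thesis
  \<comment> \<open>If \<open>p\<close> vanishes, a nonzero \<open>q\<close> or \<open>r\<close> is
    moved into the corner by a swap; if all three vanish, the matrix is its own transpose.\<close>
  proof (cases "q = 0 \<or> p \<noteq> 0")
    case False
    then show ?thesis using *[of q p s r] by (metis lattice_count_swap_cols lattice_count_swap_rows)
  next
    case True
    then show ?thesis
      using *[of p q r s] *[of r s p q] by (metis lattice_count_swap_cols lattice_count_swap_rows)
  qed
qed

subsection \<open>Integral bilinear forms\<close>

lemma bform_expand:
  fixes u v :: "'a::comm_ring_1 vec"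
  assumes "T \<in> carrier_mat k k" "u \<in> carrier_vec k" "v \<in> carrier_vec k"
  shows "bform T u v = (\<Sum>i<k. \<Sum>j<k. u $ i * (of_int (T $$ (i, j)) * v $ j))"
  using assms by (auto simp: bform_def scalar_prod_def row_def sum_distrib_left
      atLeast0LessThan intro!: sum.cong)

lemma bform_sym:
  fixes u v :: "'a::comm_ring_1 vec"
  assumes T: "T \<in> carrier_mat k k" "transpose_mat T = T" and u: "u \<in> carrier_vec k" and v: "v \<in> carrier_vec k"
  shows "bform T u v = bform T v u"
proof -
  have "T $$ (i, j) = T $$ (j, i)" if "i < k" "j < k" for i j
    using T that by (metis carrier_matD index_transpose_mat(1))
  then show ?thesis
    unfolding bform_expand[OF T(1) u v] bform_expand[OF T(1) v u]
    by (subst sum.swap) (auto intro!: sum.cong simp: algebra_simps)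
qed

lemma bform_add_left:
  fixes u v x :: "'a::comm_ring_1 vec"
  assumes "T \<in> carrier_mat k k" "u \<in> carrier_vec k" "v \<in> carrier_vec k" "x \<in> carrier_vec k"
  shows "bform T (u + v) x = bform T u x + bform T v x"
  using assms by (simp add: bform_expand[where k = k] algebra_simps sum.distrib)

lemma bform_add_right:
  fixes u v x :: "'a::comm_ring_1 vec"
  assumes "T \<in> carrier_mat k k" "u \<in> carrier_vec k" "v \<in> carrier_vec k" "x \<in> carrier_vec k"
  shows "bform T x (u + v) = bform T x u + bform T x v"
  using assms by (simp add: bform_expand[where k = k] algebra_simps sum.distrib)

lemma bform_smult_left:
  fixes u x :: "'a::comm_ring_1 vec"
  assumes "T \<in> carrier_mat k k" "u \<in> carrier_vec k" "x \<in> carrier_vec k"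
  shows "bform T (c \<cdot>\<^sub>v u) x = c * bform T u x"
  using assms by (simp add: bform_expand[where k = k] algebra_simps sum_distrib_left)

lemma bform_smult_right:
  fixes u x :: "'a::comm_ring_1 vec"
  assumes "T \<in> carrier_mat k k" "u \<in> carrier_vec k" "x \<in> carrier_vec k"
  shows "bform T x (c \<cdot>\<^sub>v u) = c * bform T x u"
  using assms by (simp add: bform_expand[where k = k] algebra_simps sum_distrib_left)

lemma qform_smult:
  fixes u :: "'a::comm_ring_1 vec"
  assumes "T \<in> carrier_mat k k" "u \<in> carrier_vec k"
  shows "qform T (c \<cdot>\<^sub>v u) = c\<^sup>2 * qform T u"
  using assms by (simp add: qform_def bform_smult_left bform_smult_right power2_eq_square)

lemma qform_add:
  fixes u v :: "'a::comm_ring_1 vec"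
  assumes "T \<in> carrier_mat k k" "transpose_mat T = T" "u \<in> carrier_vec k" "v \<in> carrier_vec k"
  shows "qform T (u + v) = qform T u + 2 * bform T u v + qform T v"
  using assms bform_sym[of T k v u]
  by (simp add: qform_def bform_add_left bform_add_right[where k = k])

section \<open>Block coordinates and the pairing with the lift of Z\<close>

lemma dim_triple [simp]: "dim_vec (triple a x b) = dim_vec x + 2"
  by (simp add: triple_def)

lemma triple_carrier: "triple a x b \<in> carrier_vec (k + 2) \<longleftrightarrow> x \<in> carrier_vec k"
  unfolding carrier_vec_def mem_Collect_eq dim_triple by linarith

lemma index_triple:
  assumes "i < dim_vec x + 2"
  shows "triple a x b $ i = (if i = 0 then a else if i = Suc (dim_vec x) then b else x $ (i - 1))"
  using assms by (cases i) (auto simp: triple_def less_Suc_eq)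

lemma map_vec_triple: "map_vec f (triple a x b) = triple (f a) (map_vec f x) (f b)"
  by (intro eq_vecI) (auto simp: index_triple)

lemma triple_eq_iff:
  assumes "x \<in> carrier_vec k" "y \<in> carrier_vec k"
  shows "triple a x b = triple c y d \<longleftrightarrow> a = c \<and> x = y \<and> b = d"
proof
  assume "triple a x b = triple c y d"
  then have "a = c" and *: "x @\<^sub>v vCons b vNil = y @\<^sub>v vCons d vNil" by (simp_all add: triple_def)
  moreover have "x = y" "vCons b vNil = vCons d vNil"
    using * append_vec_eq[OF assms] by blast+
  ultimately show "a = c \<and> x = y \<and> b = d" by simp
qed simp

lemma triple_add:
  assumes "x \<in> carrier_vec k" "y \<in> carrier_vec k"
  shows "triple a x b + triple c y d = triple (a + c) (x + y) (b + d)"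
  using assms by (intro eq_vecI) (auto simp: index_triple)

lemma triple_cases:
  assumes "v \<in> carrier_vec (k + 2)"
  obtains a x b where "v = triple a x b" "x \<in> carrier_vec k"
proof (rule that[of "v $ 0" "vec k (\<lambda>i. v $ Suc i)" "v $ Suc k"])
  show "v = triple (v $ 0) (vec k (\<lambda>i. v $ Suc i)) (v $ Suc k)"
    using assms by (intro eq_vecI) (auto simp: index_triple)
qed simp

lemma bform_hyp_border:
  fixes x y :: "'a::comm_ring_1 vec"
  assumes T: "T \<in> carrier_mat k k" and x: "x \<in> carrier_vec k" and y: "y \<in> carrier_vec k"
  shows "bform (hyp_border T) (triple a x b) (triple c y d) = a * d + b * c + bform T x y"
proof -
  let ?v = "triple a x b" and ?w = "triple c y d"
  have dim: "hyp_border T \<in> carrier_mat (Suc (Suc k)) (Suc (Suc k))"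
    using T by (auto intro: carrier_matI)
  have v: "?v \<in> carrier_vec (Suc (Suc k))" "?w \<in> carrier_vec (Suc (Suc k))"
    using x y by (auto simp: triple_def intro!: carrier_vecI)
  have v0: "?v $ 0 = a" "?w $ 0 = c" by (simp_all add: triple_def)
  have vi: "?v $ Suc i = x $ i" "?w $ Suc i = y $ i" if "i < k" for i
    using x y that by (simp_all add: triple_def)
  have vk: "?v $ Suc k = b" "?w $ Suc k = d"
    using x y by (simp_all add: triple_def)
  have M: "hyp_border T $$ (i, j) =
      (if i = 0 \<and> j = k + 1 \<or> i = k + 1 \<and> j = 0 then 1
       else if 1 \<le> i \<and> i \<le> k \<and> 1 \<le> j \<and> j \<le> k then T $$ (i - 1, j - 1) else 0)"
    if "i < Suc (Suc k)" "j < Suc (Suc k)" for i j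
    using T that by (simp add: hyp_border_def Let_def)
  have split: "(\<Sum>i<Suc (Suc k). f i) = f 0 + (\<Sum>i<k. f (Suc i)) + f (Suc k)" for f :: "nat \<Rightarrow> 'a"
    unfolding sum.lessThan_Suc[of f "Suc k"] sum.lessThan_Suc_shift[of f k] by simp
  show ?thesis
    unfolding bform_expand[OF dim v] bform_expand[OF T x y] split
    by (simp add: M v0 vi vk algebra_simps)
qed

lemma bform_uminus_mat:
  fixes x y :: "'a::comm_ring_1 vec"
  assumes "T \<in> carrier_mat k k" "x \<in> carrier_vec k" "y \<in> carrier_vec k"
  shows "bform (- T) x y = - bform T x y"
  using assms by (simp add: bform_expand[where k = k] sum_negf)

text \<open>Each hyperbolic plane pairs opposite slots, so \<open>x2\<close> meets z' and
  \<open>x3\<close> meets z, while \<open>x4\<close> meets the quadratic first entry of the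
  lift.\<close>

lemma bform_Z_lift:
  assumes S: "S \<in> carrier_mat m m" and x: "x \<in> carrier_vec m" and w: "w \<in> carrier_vec m"
  shows "bform (Q_mat S) (triple x1 (triple x2 x x3) x4) (Z_lift S (triple z w z')) =
    x1 + x2 * z' + x3 * z - bform S x w - x4 * (z * z' - qform S w / 2)"
proof -
  have S1: "- S \<in> carrier_mat m m" "hyp_border (- S) \<in> carrier_mat (m + 2) (m + 2)"
    using S by (auto intro: carrier_matI)
  have "triple x2 x x3 \<in> carrier_vec (m + 2)" "triple z w z' \<in> carrier_vec (m + 2)"
    using x w by (simp_all only: triple_carrier)
  note Q = bform_hyp_border[OF S1(2) this] bform_hyp_border[OF S1(1) x w] qform_hyp_border[OF S1(1) w]
    bform_uminus_mat[OF S x w] qform_uminus[OF S w]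
  show ?thesis
    unfolding Z_lift_def Q_mat_def Q1_mat_def Q by (simp add: field_simps)
qed

lemma bform_Complex:
  assumes "S \<in> carrier_mat m m" "x \<in> carrier_vec m" "w \<in> carrier_vec m"
  shows "bform S (map_vec of_real x) w = Complex (bform S x (map_vec Re w)) (bform S x (map_vec Im w))"
  using assms by (simp add: bform_expand[where k = m] complex_eq_iff)

lemma qform_Complex:
  assumes S: "S \<in> carrier_mat m m" "transpose_mat S = S" and w: "w \<in> carrier_vec m"
  shows "qform S w = Complex (qform S (map_vec Re w) - qform S (map_vec Im w))
     (2 * bform S (map_vec Re w) (map_vec Im w))"
proof -
  have "bform S (map_vec Im w) (map_vec Re w) = bform S (map_vec Re w) (map_vec Im w)"
    using S w by (intro bform_sym) auto
  then show ?thesis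
    using S w unfolding qform_def
    by (simp add: bform_expand[where k = m] complex_eq_iff sum_subtractf sum.distrib algebra_simps)
qed

lemma Im_qform_smult:
  fixes w :: "complex vec"
  assumes "S \<in> carrier_mat m m" "w \<in> carrier_vec m"
  shows "qform S (map_vec Im (of_real c \<cdot>\<^sub>v w)) = c\<^sup>2 * qform S (map_vec Im w)"
proof -
  have "map_vec Im (of_real c \<cdot>\<^sub>v w) = c \<cdot>\<^sub>v map_vec Im w" by (intro eq_vecI) simp_all
  then show ?thesis using assms by (simp add: qform_smult)
qed

text \<open>Positivity at S[y] x - S(x, y) y, the projection of x away from y with its denominator
  cleared.\<close>

lemma positive_definite_cauchy_schwarz:
  fixes x y :: "real vec"
  assumes S: "S \<in> carrier_mat m m" "transpose_mat S = S" "positive_definite S"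
    and x: "x \<in> carrier_vec m" and y: "y \<in> carrier_vec m"
  shows "(bform S x y)\<^sup>2 \<le> qform S y * qform S x"
proof (cases "y = 0\<^sub>v m")
  case True
  then show ?thesis using S x by (simp add: qform_def bform_expand[where k = m])
next
  case False
  have pos: "qform S y > 0" using False S y by (auto simp: positive_definite_def)
  let ?u = "qform S y \<cdot>\<^sub>v x" and ?v = "(- bform S x y) \<cdot>\<^sub>v y"
  have "0 \<le> qform S (?u + ?v)"
  proof (cases "?u + ?v = 0\<^sub>v m")
    case True
    then show ?thesis using S by (simp only: True) (simp add: qform_def bform_expand[where k = m])
  qed (use S x y in \<open>auto simp: positive_definite_def less_imp_le\<close>)
  also have "\<dots> = (qform S y)\<^sup>2 * qform S x + 2 * (qform S y * (- bform S x y * bform S x y))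
      + (- bform S x y)\<^sup>2 * qform S y"
    using S x y by (simp add: qform_add[where k = m] qform_smult[where k = m]
        bform_smult_left[where k = m] bform_smult_right[where k = m])
  also have "\<dots> = qform S y * (qform S y * qform S x - (bform S x y)\<^sup>2)"
    by (simp add: algebra_simps power2_eq_square)
  finally show ?thesis using pos by (simp add: zero_le_mult_iff)
qed

text \<open>The \<open>j\<close>-th coordinate of \<open>x\<close> is the pairing of \<open>x\<close> with \<open>S\<^sup>-\<^sup>1 e\<^sub>j\<close>, so that no compactness
  argument is needed.\<close>
lemma positive_definite_coord_bound:
  assumes S: "S \<in> carrier_mat m m" "transpose_mat S = S" "positive_definite S" and j: "j < m"
  shows "\<exists>C\<ge>0. \<forall>x\<in>carrier_vec m. (x $ j)\<^sup>2 \<le> C * qform S (x :: real vec)"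
proof -
  let ?S = "map_mat of_int S :: real mat"
  have A: "?S \<in> carrier_mat m m" using S by simp
  have "det ?S \<noteq> 0"
  proof
    assume "det ?S = 0"
    then obtain v where v: "v \<in> carrier_vec m" "v \<noteq> 0\<^sub>v m" "?S *\<^sub>v v = 0\<^sub>v m"
      using det_0_iff_vec_prod_zero_field[OF A] by blast
    then have "qform S v = 0" by (simp add: qform_def bform_def)
    then show False using v S by (auto simp: positive_definite_def)
  qed
  then obtain B where B: "B \<in> carrier_mat m m" "?S * B = 1\<^sub>m m"
    using det_non_zero_imp_unit[OF A, of "()"] by (auto simp: Units_def ring_mat_def)
  define y where "y = B *\<^sub>v unit_vec m j"
  have y: "y \<in> carrier_vec m" using B by (simp add: y_def)
  have Sy: "?S *\<^sub>v y = unit_vec m j"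
    using assoc_mult_mat_vec[OF A B(1), of "unit_vec m j"] B(2) by (simp add: y_def)
  have "(x $ j)\<^sup>2 \<le> qform S y * qform S x" if x: "x \<in> carrier_vec m" for x
  proof -
    have "x $ j = bform S x y" using x j by (simp add: bform_def Sy)
    then show ?thesis using positive_definite_cauchy_schwarz[OF S x y] by simp
  qed
  moreover have "qform S y \<ge> 0"
    using S y by (cases "y = 0\<^sub>v m") (auto simp: positive_definite_def qform_def bform_expand[where k = m] less_imp_le)
  ultimately show ?thesis by blast
qed

text \<open>Hides the constant, so that linear changes of coordinates can be undone without tracking
  it.\<close>

definition dominated :: "'a set \<Rightarrow> ('a \<Rightarrow> real) \<Rightarrow> ('a \<Rightarrow> real) \<Rightarrow> bool" where
  "dominated T P f \<longleftrightarrow> (\<exists>C\<ge>0. \<forall>t\<in>T. (f t)\<^sup>2 \<le> C * P t)"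

lemma dominatedI: "C \<ge> 0 \<Longrightarrow> (\<And>t. t \<in> T \<Longrightarrow> (f t)\<^sup>2 \<le> C * P t) \<Longrightarrow> dominated T P f"
  by (auto simp: dominated_def)

lemma dominated_add:
  assumes "dominated T P f" "dominated T P g"
  shows "dominated T P (\<lambda>t. f t + g t)"
proof -
  obtain C D where C: "C \<ge> 0" "\<And>t. t \<in> T \<Longrightarrow> (f t)\<^sup>2 \<le> C * P t"
    and D: "D \<ge> 0" "\<And>t. t \<in> T \<Longrightarrow> (g t)\<^sup>2 \<le> D * P t"
    using assms unfolding dominated_def by blast
  show ?thesis
  proof (rule dominatedI[of "2 * C + 2 * D"])
    fix t assume t: "t \<in> T"
    have "(f t + g t)\<^sup>2 \<le> 2 * (f t)\<^sup>2 + 2 * (g t)\<^sup>2"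
      using zero_le_power2[of "f t - g t"] by (simp add: power2_eq_square algebra_simps)
    also have "\<dots> \<le> 2 * (C * P t) + 2 * (D * P t)" using C(2)[OF t] D(2)[OF t] by simp
    finally show "(f t + g t)\<^sup>2 \<le> (2 * C + 2 * D) * P t" by (simp add: algebra_simps)
  qed (use C D in simp)
qed

lemma dominated_cmult:
  assumes "dominated T P f"
  shows "dominated T P (\<lambda>t. c * f t)"
proof -
  obtain C where C: "C \<ge> 0" "\<And>t. t \<in> T \<Longrightarrow> (f t)\<^sup>2 \<le> C * P t"
    using assms unfolding dominated_def by blast
  show ?thesis
    using C by (intro dominatedI[of "c\<^sup>2 * C"])
      (auto simp: power_mult_distrib mult.assoc intro: mult_left_mono)
qed

lemma dominated_sum:
  assumes "finite I" "\<And>i. i \<in> I \<Longrightarrow> dominated T P (f i)"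
  shows "dominated T P (\<lambda>t. \<Sum>i\<in>I. f i t)"
  using assms
proof (induction I rule: finite_induct)
  case empty
  show ?case by (rule dominatedI[of 0]) auto
qed (simp add: dominated_add)

lemma dominated_cong: "(\<And>t. t \<in> T \<Longrightarrow> f t = g t) \<Longrightarrow> dominated T P f \<longleftrightarrow> dominated T P g"
  by (simp add: dominated_def)

subsection \<open>Gaussian sums\<close>

lemma summable_on_Times_nonneg:
  fixes f :: "'a \<Rightarrow> real" and g :: "'b \<Rightarrow> real"
  assumes "f summable_on A" "g summable_on B" "\<And>x. f x \<ge> 0" "\<And>x. g x \<ge> 0"
  shows "(\<lambda>(x, y). f x * g y) summable_on A \<times> B"
proof (rule summable_on_SigmaI)
  show "((\<lambda>y. case (x, y) of (x, y) \<Rightarrow> f x * g y) has_sum (f x * infsum g B)) B" for x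
    using assms(2) by (simp add: has_sum_cmult_right)
  show "(\<lambda>x. f x * infsum g B) summable_on A" using assms(1) by (rule summable_on_cmult_left)
qed (use assms in auto)

text \<open>On the naturals k \<le> k^2 bounds the terms by a geometric series; the integers are
  covered by the naturals and their negatives.\<close>

lemma gaussian_summable_int:
  assumes "(c :: real) > 0"
  shows "(\<lambda>k::int. exp (- c * (of_int k)\<^sup>2)) summable_on UNIV"
proof -
  have nat: "(\<lambda>n::nat. exp (- c * (real n)\<^sup>2)) summable_on UNIV"
  proof (rule summable_nonneg_imp_summable_on)
    show "summable (\<lambda>n::nat. exp (- c * (real n)\<^sup>2))"
    proof (rule summable_comparison_test')
      show "summable (\<lambda>n. exp (- c) ^ n)" using assms by (simp add: summable_geometric)
      fix n :: nat
      have "real n \<le> (real n)\<^sup>2" by (cases n) (auto simp: power2_eq_square)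
      then have "exp (- c * (real n)\<^sup>2) \<le> exp (- c) ^ n" using assms by (simp flip: exp_of_nat_mult)
      then show "norm (exp (- c * (real n)\<^sup>2)) \<le> exp (- c) ^ n" by simp
    qed
  qed simp
  have "(UNIV :: int set) = range int \<union> range (\<lambda>n. - int n)"
  proof (intro equalityI subsetI)
    show "k \<in> range int \<union> range (\<lambda>n. - int n)" for k by (cases k rule: int_cases2) auto
  qed simp
  moreover have "(\<lambda>k::int. exp (- c * (of_int k)\<^sup>2)) summable_on range int"
    using nat by (subst summable_on_reindex) (auto simp: o_def)
  moreover have "(\<lambda>k::int. exp (- c * (of_int k)\<^sup>2)) summable_on range (\<lambda>n. - int n)"
    using nat by (subst summable_on_reindex) (auto simp: o_def inj_on_def)
  ultimately show ?thesis using summable_on_union by metis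
qed

text \<open>The Gaussian factors over the coordinates, and \<open>vCons\<close> splits off one
  coordinate at a time.\<close>

lemma gaussian_summable_int_vec:
  assumes c: "(c :: real) > 0"
  shows "(\<lambda>k::int vec. exp (- c * (\<Sum>j<m. (of_int (k $ j))\<^sup>2))) summable_on carrier_vec m"
proof (induction m)
  case 0
  have "finite (carrier_vec 0 :: int vec set)" by (rule finite_subset[of _ "{vNil}"]) auto
  then show ?case by simp
next
  case (Suc m)
  have inj: "inj_on (\<lambda>(a, v). vCons a v) (UNIV \<times> carrier_vec m :: (int \<times> int vec) set)"
    by (auto simp: inj_on_def)
  have "carrier_vec (Suc m) = (\<lambda>(a, v). vCons a v) ` (UNIV \<times> carrier_vec m :: (int \<times> int vec) set)"
  proof (intro equalityI subsetI)
    fix v :: "int vec" assume "v \<in> carrier_vec (Suc m)"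
    then show "v \<in> (\<lambda>(a, v). vCons a v) ` (UNIV \<times> carrier_vec m)"
      by (cases v) (auto dest: carrier_vecD intro: carrier_vecI)
  qed auto
  moreover have "(\<lambda>(a, v). exp (- c * (of_int a)\<^sup>2) * exp (- c * (\<Sum>j<m. (of_int (v $ j))\<^sup>2)))
      summable_on (UNIV \<times> carrier_vec m :: (int \<times> int vec) set)"
    by (intro summable_on_Times_nonneg gaussian_summable_int c Suc) auto
  then have "((\<lambda>k::int vec. exp (- c * (\<Sum>j<Suc m. (of_int (k $ j))\<^sup>2))) \<circ> (\<lambda>(a, v). vCons a v))
      summable_on (UNIV \<times> carrier_vec m)"
    by (rule summable_on_cong[THEN iffD1, rotated])
      (auto simp: sum.lessThan_Suc_shift algebra_simps simp flip: exp_add simp del: sum.lessThan_Suc)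
  ultimately show ?case by (simp add: summable_on_reindex[OF inj])
qed

subsection \<open>The majorant\<close>

lemma dominated_sum_squares:
  assumes "finite I" "\<And>i. i \<in> I \<Longrightarrow> dominated T P (f i)"
  shows "\<exists>C\<ge>0. \<forall>t\<in>T. (\<Sum>i\<in>I. (f i t)\<^sup>2) \<le> C * P t"
proof -
  obtain C where C: "\<And>i. i \<in> I \<Longrightarrow> C i \<ge> 0 \<and> (\<forall>t\<in>T. (f i t)\<^sup>2 \<le> C i * P t)"
    using assms(2) unfolding dominated_def by metis
  have "(\<Sum>i\<in>I. (f i t)\<^sup>2) \<le> sum C I * P t" if "t \<in> T" for t
    unfolding sum_distrib_right using C that by (intro sum_mono) auto
  moreover have "sum C I \<ge> 0" using C by (intro sum_nonneg) auto
  ultimately show ?thesis by blast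
qed

text \<open>Q(\<lambda>, Z~) for \<lambda> = (x1, x2, x, x3, x4) and Z~ the lift of Z. The outer
  coordinates are real, not integral, because they are later divided by the square root of
  n.\<close>

definition lift_pairing ::
  "int mat \<Rightarrow> complex \<Rightarrow> complex vec \<Rightarrow> complex \<Rightarrow> real \<Rightarrow> real \<Rightarrow> real \<Rightarrow> real \<Rightarrow> real vec \<Rightarrow> complex" where
  "lift_pairing S z w z' x1 x2 x3 x4 x =
     x1 + x2 * z' + x3 * z - bform S (map_vec of_real x) w - x4 * (z * z' - qform S w / 2)"

definition lift_norm :: "int mat \<Rightarrow> complex \<Rightarrow> complex vec \<Rightarrow> complex \<Rightarrow> real" where
  "lift_norm S z w z' = 2 * Im z * Im z' - qform S (map_vec Im w)"

text \<open>Siegel's majorant q(\<lambda>_v) - q(\<lambda>_v^perp): the quotient is twice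
  q(\<lambda>_v), and the bracket is q(\<lambda>).\<close>

definition majorant ::
  "int mat \<Rightarrow> complex \<Rightarrow> complex vec \<Rightarrow> complex \<Rightarrow> real \<Rightarrow> real \<Rightarrow> real \<Rightarrow> real \<Rightarrow> real vec \<Rightarrow> real" where
  "majorant S z w z' x1 x2 x3 x4 x =
     (cmod (lift_pairing S z w z' x1 x2 x3 x4 x))\<^sup>2 / lift_norm S z w z'
       - (x1 * x4 + x2 * x3 - qform S x / 2)"

text \<open>Completing squares: \<open>t\<close>, \<open>p\<close>, \<open>r\<close> are the coordinates after the unipotent isometries that
  move \<open>Z\<close> first to \<open>i Im Z\<close> and then to a point with \<open>w = 0\<close>. The letters \<open>sxu\<close>, \<open>sxv\<close>, \<dots> stand
  for the values of \<open>S\<close> on \<open>x\<close>, \<open>u = Re w\<close>, \<open>v = Im w\<close>.\<close>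
lemma majorant_identity:
  fixes X Y X' Y' q r :: real
  assumes q: "q = 2 * Y * Y' - svv" "q \<noteq> 0" and Y': "Y' \<noteq> 0"
    and r: "r = x3 - x4 * X'"
    and p: "p = x2 - x4 * X - (sxv - x4 * suv) / Y' + r * svv / (2 * Y'\<^sup>2)"
    and t: "t = x1 + x2 * X' + x3 * X - sxu - x4 * (X * X' - suu / 2)"
    and s: "s = sxx + x4\<^sup>2 * suu + (r / Y')\<^sup>2 * svv - 2 * x4 * sxu - 2 * (r / Y') * sxv
                + 2 * x4 * (r / Y') * suv"
  shows "((x1 + x2 * X' + x3 * X - sxu - x4 * (X * X' - Y * Y' - (suu - svv) / 2))\<^sup>2
        + (x2 * Y' + x3 * Y - sxv - x4 * (X * Y' + Y * X' - suv))\<^sup>2) / q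
        - (x1 * x4 + x2 * x3 - sxx / 2)
      = t\<^sup>2 / q + q / 4 * x4\<^sup>2 + Y'\<^sup>2 / q * p\<^sup>2 + q / (4 * Y'\<^sup>2) * r\<^sup>2 + s / 2"
proof -
  \<comment> \<open>\<open>A\<close> and \<open>B\<close> rewrite the real and imaginary parts of
    the pairing, \<open>C\<close> half of the quadratic form. In the final sum the cross terms t *
    x4 and p * r of the squares cancel against those in \<open>C\<close>.\<close>
  have A: "x1 + x2 * X' + x3 * X - sxu - x4 * (X * X' - Y * Y' - (suu - svv) / 2) = t + x4 * q / 2"
    unfolding t q(1) by (simp add: algebra_simps diff_divide_distrib add_divide_distrib)
  have B: "x2 * Y' + x3 * Y - sxv - x4 * (X * Y' + Y * X' - suv) = Y' * p + r * q / (2 * Y')"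
    unfolding p r q(1) using Y' by (simp add: field_simps power2_eq_square)
  have C: "x1 * x4 + x2 * x3 - sxx / 2 = t * x4 + p * r - s / 2"
    unfolding s p t r using Y' by (simp add: field_simps power2_eq_square)
  show ?thesis
    unfolding A B C using q(2) Y' by (simp add: field_simps power2_eq_square)
qed

section \<open>Coercivity of the majorant at a fixed point\<close>

locale theta_point =
  fixes m :: nat and S :: "int mat" and z z' :: complex and w :: "complex vec"
  assumes S: "S \<in> carrier_mat m m" "transpose_mat S = S" "positive_definite S"
    and w: "w \<in> carrier_vec m" and Im_z': "Im z' > 0" and norm_pos: "lift_norm S z w z' > 0"
begin

abbreviation "q \<equiv> lift_norm S z w z'"

text \<open>The letters r, p, t of \<open>majorant_identity\<close> become
  \<open>shear_coeff\<close>, \<open>shear_snd\<close>, \<open>shear_fst\<close>, and s becomes the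
  value of S at \<open>shear_vec\<close>; \<open>x4\<close> stays fixed.\<close>

definition shear_coeff :: "real \<Rightarrow> real \<Rightarrow> real" where
  "shear_coeff x3 x4 = x3 - x4 * Re z'"

definition shear_vec :: "real \<Rightarrow> real \<Rightarrow> real vec \<Rightarrow> real vec" where
  "shear_vec x3 x4 x = x + ((- x4) \<cdot>\<^sub>v map_vec Re w + (- shear_coeff x3 x4 / Im z') \<cdot>\<^sub>v map_vec Im w)"

definition shear_snd :: "real \<Rightarrow> real \<Rightarrow> real \<Rightarrow> real vec \<Rightarrow> real" where
  "shear_snd x2 x3 x4 x = x2 - x4 * Re z
     - (bform S x (map_vec Im w) - x4 * bform S (map_vec Re w) (map_vec Im w)) / Im z'
     + shear_coeff x3 x4 * qform S (map_vec Im w) / (2 * (Im z')\<^sup>2)"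

definition shear_fst :: "real \<Rightarrow> real \<Rightarrow> real \<Rightarrow> real \<Rightarrow> real vec \<Rightarrow> real" where
  "shear_fst x1 x2 x3 x4 x = x1 + x2 * Re z' + x3 * Re z - bform S x (map_vec Re w)
     - x4 * (Re z * Re z' - qform S (map_vec Re w) / 2)"

lemma majorant_eq:
  assumes x: "x \<in> carrier_vec m"
  shows "majorant S z w z' x1 x2 x3 x4 x =
    (shear_fst x1 x2 x3 x4 x)\<^sup>2 / q + q / 4 * x4\<^sup>2 + (Im z')\<^sup>2 / q * (shear_snd x2 x3 x4 x)\<^sup>2
    + q / (4 * (Im z')\<^sup>2) * (shear_coeff x3 x4)\<^sup>2 + qform S (shear_vec x3 x4 x) / 2"
proof -
  let ?u = "map_vec Re w" and ?v = "map_vec Im w"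
  have u: "?u \<in> carrier_vec m" and v: "?v \<in> carrier_vec m" using w by simp_all
  have "Re (lift_pairing S z w z' x1 x2 x3 x4 x) =
      x1 + x2 * Re z' + x3 * Re z - bform S x ?u
        - x4 * (Re z * Re z' - Im z * Im z' - (qform S ?u - qform S ?v) / 2)"
    by (simp add: lift_pairing_def bform_Complex[OF S(1) x w] qform_Complex[OF S(1,2) w])
  moreover have "Im (lift_pairing S z w z' x1 x2 x3 x4 x) =
      x2 * Im z' + x3 * Im z - bform S x ?v
        - x4 * (Re z * Im z' + Im z * Re z' - bform S ?u ?v)"
    by (simp add: lift_pairing_def bform_Complex[OF S(1) x w] qform_Complex[OF S(1,2) w])
  moreover have "qform S (shear_vec x3 x4 x) = qform S x + x4\<^sup>2 * qform S ?u
      + (shear_coeff x3 x4 / Im z')\<^sup>2 * qform S ?v - 2 * x4 * bform S x ?u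
      - 2 * (shear_coeff x3 x4 / Im z') * bform S x ?v
      + 2 * x4 * (shear_coeff x3 x4 / Im z') * bform S ?u ?v"
    unfolding shear_vec_def using S x u v
    by (simp add: qform_add[where k = m] qform_smult[where k = m] bform_add_right[where k = m]
        bform_smult_left[where k = m] bform_smult_right[where k = m] algebra_simps)
  ultimately show ?thesis
    unfolding majorant_def cmod_power2
    using Im_z' norm_pos
    by (simp only:) (rule majorant_identity,
      simp_all add: lift_norm_def shear_coeff_def shear_snd_def shear_fst_def)
qed

lemma qform_nonneg: "x \<in> carrier_vec m \<Longrightarrow> qform S (x :: real vec) \<ge> 0"
  using S by (cases "x = 0\<^sub>v m")
    (auto simp: positive_definite_def qform_def bform_expand[where k = m] less_imp_le)

lemma shear_vec_carrier: "x \<in> carrier_vec m \<Longrightarrow> shear_vec x3 x4 x \<in> carrier_vec m"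
  using w by (simp add: shear_vec_def)

definition majorized :: "(real \<times> real \<times> real \<times> real \<times> real vec \<Rightarrow> real) \<Rightarrow> bool" where
  "majorized f \<longleftrightarrow> dominated {(x1, x2, x3, x4, x). x \<in> carrier_vec m}
     (\<lambda>(x1, x2, x3, x4, x). majorant S z w z' x1 x2 x3 x4 x) f"

lemma majorized_cong: "(\<And>x1 x2 x3 x4 x. x \<in> carrier_vec m \<Longrightarrow> f (x1, x2, x3, x4, x) = g (x1, x2, x3, x4, x))
    \<Longrightarrow> majorized f \<Longrightarrow> majorized g"
  unfolding majorized_def by (erule dominated_cong[THEN iffD1, rotated]) auto

lemma majorant_nonneg: "x \<in> carrier_vec m \<Longrightarrow> majorant S z w z' x1 x2 x3 x4 x \<ge> 0"
  using norm_pos qform_nonneg[OF shear_vec_carrier] by (simp add: majorant_eq)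

lemma majorizedI:
  assumes "C > 0"
    and "\<And>x1 x2 x3 x4 x. x \<in> carrier_vec m \<Longrightarrow>
      C * (f (x1, x2, x3, x4, x))\<^sup>2 \<le> majorant S z w z' x1 x2 x3 x4 x"
  shows "majorized f"
  unfolding majorized_def by (rule dominatedI[of "1 / C"]) (use assms in \<open>auto simp: field_simps\<close>)

lemma majorized_lincomb:
  assumes "majorized f" "majorized g"
  shows "majorized (\<lambda>t. a * f t + b * g t)"
  using assms unfolding majorized_def by (intro dominated_add dominated_cmult)

text \<open>By \<open>majorant_eq\<close> the majorant is a sum of nonnegative terms in sheared coordinates; the
  unipotent change of coordinates is undone one variable at a time.\<close>
lemma majorized_coords:
  shows "majorized (\<lambda>(x1, x2, x3, x4, x). x1)" "majorized (\<lambda>(x1, x2, x3, x4, x). x2)"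
    "majorized (\<lambda>(x1, x2, x3, x4, x). x3)" "majorized (\<lambda>(x1, x2, x3, x4, x). x4)"
    "j < m \<Longrightarrow> majorized (\<lambda>(x1, x2, x3, x4, x). x $ j)"
proof -
  note pos = norm_pos Im_z'
  have nn: "(shear_fst x1 x2 x3 x4 x)\<^sup>2 / q \<ge> 0" "q / 4 * x4\<^sup>2 \<ge> 0"
      "(Im z')\<^sup>2 / q * (shear_snd x2 x3 x4 x)\<^sup>2 \<ge> 0"
      "q / (4 * (Im z')\<^sup>2) * (shear_coeff x3 x4)\<^sup>2 \<ge> 0" for x1 x2 x3 x4 x
    using pos by simp_all
  have le: "(shear_fst x1 x2 x3 x4 x)\<^sup>2 / q \<le> majorant S z w z' x1 x2 x3 x4 x"
      "q / 4 * x4\<^sup>2 \<le> majorant S z w z' x1 x2 x3 x4 x"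
      "(Im z')\<^sup>2 / q * (shear_snd x2 x3 x4 x)\<^sup>2 \<le> majorant S z w z' x1 x2 x3 x4 x"
      "q / (4 * (Im z')\<^sup>2) * (shear_coeff x3 x4)\<^sup>2 \<le> majorant S z w z' x1 x2 x3 x4 x"
    if x: "x \<in> carrier_vec m" for x1 x2 x3 x4 x
    using nn(1)[of x1 x2 x3 x4 x] nn(2)[of x4] nn(3)[of x2 x3 x4 x] nn(4)[of x3 x4] qform_nonneg[OF shear_vec_carrier[OF x, of x3 x4]]
    unfolding majorant_eq[OF x] by linarith+
  show d4: "majorized (\<lambda>(x1, x2, x3, x4, x). x4)"
    by (rule majorizedI[of "q / 4"]) (use pos le(2) in simp_all)
  have dr: "majorized (\<lambda>(x1, x2, x3, x4, x). shear_coeff x3 x4)"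
    by (rule majorizedI[of "q / (4 * (Im z')\<^sup>2)"]) (use pos le(4) in simp_all)
  have dp: "majorized (\<lambda>(x1, x2, x3, x4, x). shear_snd x2 x3 x4 x)"
    by (rule majorizedI[of "(Im z')\<^sup>2 / q"]) (use pos le(3) in simp_all)
  have dt: "majorized (\<lambda>(x1, x2, x3, x4, x). shear_fst x1 x2 x3 x4 x)"
    by (rule majorizedI[of "1 / q"]) (use pos le(1) in simp_all)
  have dv: "majorized (\<lambda>(x1, x2, x3, x4, x). shear_vec x3 x4 x $ j)" if j: "j < m" for j
  proof -
    obtain C where C: "C \<ge> 0" "\<And>x :: real vec. x \<in> carrier_vec m \<Longrightarrow> (x $ j)\<^sup>2 \<le> C * qform S x"
      using positive_definite_coord_bound[OF S j] by blast
    show ?thesis unfolding majorized_def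
    \<comment> \<open>The factor 2 compensates for the half in front of the S-term in
      \<open>majorant_eq\<close>.\<close>
    proof (rule dominatedI[of "2 * C"])
      fix t :: "real \<times> real \<times> real \<times> real \<times> real vec"
      assume "t \<in> {(x1, x2, x3, x4, x). x \<in> carrier_vec m}"
      then obtain x1 x2 x3 x4 x where t: "t = (x1, x2, x3, x4, x)" and x: "x \<in> carrier_vec m"
        by auto
      have "qform S (shear_vec x3 x4 x) \<le> 2 * majorant S z w z' x1 x2 x3 x4 x"
        unfolding majorant_eq[OF x] using nn(1)[of x1 x2 x3 x4 x] nn(2)[of x4] nn(3)[of x2 x3 x4 x] nn(4)[of x3 x4] by argo
      then have "C * qform S (shear_vec x3 x4 x) \<le> C * (2 * majorant S z w z' x1 x2 x3 x4 x)"
        using C(1) by (rule mult_left_mono)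
      then show "(case t of (x1, x2, x3, x4, x) \<Rightarrow> shear_vec x3 x4 x $ j)\<^sup>2
          \<le> 2 * C * (case t of (x1, x2, x3, x4, x) \<Rightarrow> majorant S z w z' x1 x2 x3 x4 x)"
        unfolding t using C(2)[OF shear_vec_carrier[OF x], of x3 x4] by simp
    qed (use C in simp)
  qed
  \<comment> \<open>Back substitution in a triangular system: \<open>x3\<close> from r and
    \<open>x4\<close>, then x, hence its pairings with fixed vectors, then \<open>x2\<close>, and
    finally \<open>x1\<close>.\<close>
  show d3: "majorized (\<lambda>(x1, x2, x3, x4, x). x3)"
    by (rule majorized_cong[OF _ majorized_lincomb[OF dr d4, of 1 "Re z'"]]) (simp add: shear_coeff_def)
  show dx: "majorized (\<lambda>(x1, x2, x3, x4, x). x $ j)" if j: "j < m" for j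
    by (rule majorized_cong[OF _ majorized_lincomb[OF dv[OF j] majorized_lincomb[OF d4 dr,
        of "Re (w $ j)" "Im (w $ j) / Im z'"], of 1 1]])
      (use j w in \<open>simp add: shear_vec_def algebra_simps\<close>)
  have db: "majorized (\<lambda>(x1, x2, x3, x4, x). bform S x y)" if y: "y \<in> carrier_vec m" for y
  proof (rule majorized_cong)
    show "majorized (\<lambda>t. \<Sum>i<m. \<Sum>j<m. of_int (S $$ (i, j)) * y $ j * (case t of (x1, x2, x3, x4, x) \<Rightarrow> x $ i))"
      using dx unfolding majorized_def by (intro dominated_sum dominated_cmult) auto
  qed (use S y in \<open>simp add: bform_expand[where k = m] algebra_simps\<close>)
  let ?u = "map_vec Re w" and ?v = "map_vec Im w"
  have u: "?u \<in> carrier_vec m" and v: "?v \<in> carrier_vec m" using w by simp_all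
  show d2: "majorized (\<lambda>(x1, x2, x3, x4, x). x2)"
    by (rule majorized_cong[OF _ majorized_lincomb[OF majorized_lincomb[OF dp d4, of 1 "Re z - bform S ?u ?v / Im z'"]
      majorized_lincomb[OF db[OF v] dr, of "1 / Im z'" "- qform S ?v / (2 * (Im z')\<^sup>2)"], of 1 1]])
     (simp add: shear_snd_def diff_divide_distrib algebra_simps)
  show "majorized (\<lambda>(x1, x2, x3, x4, x). x1)"
    by (rule majorized_cong[OF _ majorized_lincomb[OF majorized_lincomb[OF dt majorized_lincomb[OF d2 d3, of "- Re z'" "- Re z"], of 1 1]
      majorized_lincomb[OF db[OF u] d4, of 1 "Re z * Re z' - qform S ?u / 2"], of 1 1]])
     (simp add: shear_fst_def algebra_simps)
qed

text \<open>Comparison with the Euclidean norm, which lets the theta series be bounded by a product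
  of one-dimensional Gaussian sums.\<close>

lemma majorant_coercive:
  "\<exists>c>0. \<forall>x1 x2 x3 x4. \<forall>x\<in>carrier_vec m.
     c * (x1\<^sup>2 + x2\<^sup>2 + x3\<^sup>2 + x4\<^sup>2 + (\<Sum>j<m. (x $ j)\<^sup>2)) \<le> majorant S z w z' x1 x2 x3 x4 x"
proof -
  obtain C where C: "C \<ge> 0" "\<And>x1 x2 x3 x4 x. x \<in> carrier_vec m \<Longrightarrow>
      (\<Sum>j<m. (x $ j)\<^sup>2) \<le> C * majorant S z w z' x1 x2 x3 x4 x"
    using dominated_sum_squares[OF _ majorized_coords(5)[unfolded majorized_def], of "{..<m}" "\<lambda>j. j"] by auto
  have "\<exists>C\<ge>0. \<forall>x1 x2 x3 x4. \<forall>x\<in>carrier_vec m. (f (x1, x2, x3, x4, x))\<^sup>2 \<le> C * majorant S z w z' x1 x2 x3 x4 x"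
    if "majorized f" for f
    using that unfolding majorized_def dominated_def by auto
  note e = this[OF majorized_coords(1)] this[OF majorized_coords(2)] this[OF majorized_coords(3)] this[OF majorized_coords(4)]
  obtain C1 where C1: "C1 \<ge> 0" "\<And>x1 x2 x3 x4 x. x \<in> carrier_vec m \<Longrightarrow> x1\<^sup>2 \<le> C1 * majorant S z w z' x1 x2 x3 x4 x"
    using e(1) by auto
  obtain C2 where C2: "C2 \<ge> 0" "\<And>x1 x2 x3 x4 x. x \<in> carrier_vec m \<Longrightarrow> x2\<^sup>2 \<le> C2 * majorant S z w z' x1 x2 x3 x4 x"
    using e(2) by auto
  obtain C3 where C3: "C3 \<ge> 0" "\<And>x1 x2 x3 x4 x. x \<in> carrier_vec m \<Longrightarrow> x3\<^sup>2 \<le> C3 * majorant S z w z' x1 x2 x3 x4 x"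
    using e(3) by auto
  obtain C4 where C4: "C4 \<ge> 0" "\<And>x1 x2 x3 x4 x. x \<in> carrier_vec m \<Longrightarrow> x4\<^sup>2 \<le> C4 * majorant S z w z' x1 x2 x3 x4 x"
    using e(4) by auto
  \<comment> \<open>The summand 1 makes \<open>?K\<close> positive; it preserves the bound because
    the majorant is nonnegative.\<close>
  let ?K = "C1 + C2 + C3 + C4 + C + 1"
  have K: "?K > 0" using C C1 C2 C3 C4 by simp
  have "1 / ?K * (x1\<^sup>2 + x2\<^sup>2 + x3\<^sup>2 + x4\<^sup>2 + (\<Sum>j<m. (x $ j)\<^sup>2)) \<le> majorant S z w z' x1 x2 x3 x4 x"
    if x: "x \<in> carrier_vec m" for x1 x2 x3 x4 x
  proof -
    have "x1\<^sup>2 + x2\<^sup>2 + x3\<^sup>2 + x4\<^sup>2 + (\<Sum>j<m. (x $ j)\<^sup>2) \<le> ?K * majorant S z w z' x1 x2 x3 x4 x"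
      using C(2)[OF x, of x1 x2 x3 x4] C1(2)[OF x, of x1 x2 x3 x4] C2(2)[OF x, of x2 x1 x3 x4]
        C3(2)[OF x, of x3 x1 x2 x4] C4(2)[OF x, of x4 x1 x2 x3] majorant_nonneg[OF x, of x1 x2 x3 x4]
      unfolding distrib_right by linarith
    then show ?thesis using K by (simp add: pos_divide_le_eq mult.commute)
  qed
  then show ?thesis using K by (intro exI[of _ "1 / ?K"]) simp
qed

end

subsection \<open>Theta series and Hecke translates\<close>

text \<open>By injectivity each inner sum is the sum of \<open>F\<close> over the range of its map.
  Extended by zero, all of them share one index set; exchanging the finite with the infinite sum
  leaves as weight the number of ranges containing y.\<close>

lemma sum_infsum_reindex:
  fixes F :: "'y \<times> 'x \<Rightarrow> complex" and \<phi> :: "'h \<Rightarrow> 'y \<Rightarrow> 'y"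
  assumes H: "finite H" and inj: "\<And>h. h \<in> H \<Longrightarrow> inj (\<phi> h)" and F: "F summable_on UNIV \<times> B"
  shows "(\<Sum>h\<in>H. \<Sum>\<^sub>\<infinity>(y, x)\<in>UNIV \<times> B. F (\<phi> h y, x)) =
    (\<Sum>\<^sub>\<infinity>(y, x)\<in>UNIV \<times> B. of_nat (card {h \<in> H. y \<in> range (\<phi> h)}) * F (y, x))"
proof -
  let ?G = "\<lambda>h (y, x). if y \<in> range (\<phi> h) then F (y, x) else 0"
  have sum: "?G h summable_on UNIV \<times> B" for h
  proof -
    have "F summable_on range (\<phi> h) \<times> B" using F by (rule summable_on_subset) auto
    then show ?thesis by (rule summable_on_cong_neutral[THEN iffD1, rotated -1]) (auto split: if_splits)
  qed
  have eq: "(\<Sum>\<^sub>\<infinity>(y, x)\<in>UNIV \<times> B. F (\<phi> h y, x)) = infsum (?G h) (UNIV \<times> B)" if "h \<in> H" for h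
  proof -
    let ?m = "\<lambda>(y, x). (\<phi> h y, x)"
    have "inj_on ?m (UNIV \<times> B)" using inj[OF that] by (auto simp: inj_on_def)
    then have "infsum F (?m ` (UNIV \<times> B)) = infsum (F \<circ> ?m) (UNIV \<times> B)" by (rule infsum_reindex)
    moreover have "?m ` (UNIV \<times> B) = range (\<phi> h) \<times> B" by auto
    moreover have "infsum F (range (\<phi> h) \<times> B) = infsum (?G h) (UNIV \<times> B)"
      by (rule infsum_cong_neutral) (auto split: if_splits)
    ultimately show ?thesis by (simp add: o_def case_prod_unfold)
  qed
  have "(\<Sum>h\<in>H. infsum (?G h) (UNIV \<times> B)) = infsum (\<lambda>p. \<Sum>h\<in>H. ?G h p) (UNIV \<times> B)"
    using H
  proof (induction H rule: finite_induct)
    case (insert h H)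
    have "(\<lambda>p. \<Sum>h\<in>H. ?G h p) summable_on UNIV \<times> B"
      using insert.hyps(1)
    proof (induction H rule: finite_induct)
      case (insert h H)
      then show ?case using summable_on_add[OF sum[of h] insert.IH] by simp
    qed simp
    then show ?case using insert infsum_add[OF sum[of h]] by simp
  qed simp
  also have "\<dots> = (\<Sum>\<^sub>\<infinity>(y, x)\<in>UNIV \<times> B. of_nat (card {h \<in> H. y \<in> range (\<phi> h)}) * F (y, x))"
    using H by (intro infsum_cong) (auto simp: sum.If_cases Int_def split: prod.split)
  finally show ?thesis using eq by simp
qed

text \<open>Up to the factor \<open>\<surd>n\<close>, pairing a lattice vector with a Hecke translate of \<open>Z\<close> is the same as
  pairing its image under the following maps with \<open>Z\<close> itself (see \<open>theta_term_transform\<close>).\<close>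
definition left_map :: "int \<times> int \<times> int \<Rightarrow> int \<times> int \<times> int \<times> int \<Rightarrow> int \<times> int \<times> int \<times> int" where
  "left_map = (\<lambda>(a, b, d) (x1, x2, x3, x4). (d * x1 + b * x3, d * x2 - b * x4, a * x3, a * x4))"

definition right_map :: "int \<times> int \<times> int \<Rightarrow> int \<times> int \<times> int \<times> int \<Rightarrow> int \<times> int \<times> int \<times> int" where
  "right_map = (\<lambda>(a, b, d) (x1, x2, x3, x4). (d * x1 + b * x2, a * x2, d * x3 - b * x4, a * x4))"

lemma inj_left_map: "h \<in> Hecke n \<Longrightarrow> inj (left_map h)"
  by (auto simp: left_map_def Hecke_def inj_on_def)

lemma inj_right_map: "h \<in> Hecke n \<Longrightarrow> inj (right_map h)"
  by (auto simp: right_map_def Hecke_def inj_on_def)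

text \<open>On the matrix with rows (x1, x2) and (x3, -x4), \<open>left_map\<close> is left
  multiplication by the matrix with rows (d, b) and (0, a), so its range is described column by
  column.\<close>

lemma range_left_map:
  "(y1, y2, y3, y4) \<in> range (left_map h) \<longleftrightarrow>
    (y1, y3) \<in> hecke_lattice h \<and> (y2, - y4) \<in> hecke_lattice h"
proof (cases h)
  case (fields a b d)
  have "(y1, y2, y3, y4) \<in> range (left_map h)"
    if y: "y1 = d * u + b * v" "y3 = a * v" "y2 = d * u' + b * v'" "- y4 = a * v'" for u v u' v'
    using y by (intro range_eqI[of _ _ "(u, u', v, - v')"]) (auto simp: left_map_def fields)
  moreover have "\<exists>u v. y2 = d * u + b * v \<and> - y4 = a * v" if "y2 = d * x2 - b * x4" "y4 = a * x4" for x2 x4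
    using that by (intro exI[of _ x2] exI[of _ "- x4"]) simp
  ultimately show ?thesis
    by (auto simp: hecke_lattice_def fields) (auto simp: left_map_def)
qed

text \<open>Exchanging the two middle coordinates, that is, transposing the matrix, conjugates
  \<open>right_map\<close> into \<open>left_map\<close>.\<close>

lemma range_right_map:
  "(y1, y2, y3, y4) \<in> range (right_map h) \<longleftrightarrow>
    (y1, y2) \<in> hecke_lattice h \<and> (y3, - y4) \<in> hecke_lattice h"
proof -
  have "(y1, y2, y3, y4) \<in> range (right_map h) \<longleftrightarrow> (y1, y3, y2, y4) \<in> range (left_map h)"
    by (cases h) (fastforce simp: left_map_def right_map_def image_iff)
  then show ?thesis by (simp add: range_left_map)
qed

text \<open>The arithmetic core: the two range descriptions turn the counts into
  \<open>lattice_count\<close> of a matrix and of its transpose.\<close>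

lemma card_left_eq_right:
  "card {h \<in> Hecke n. y \<in> range (left_map h)} = card {h \<in> Hecke n. y \<in> range (right_map h)}"
  by (cases y) (simp add: range_left_map range_right_map card_hecke_eq_lattice_count
      lattice_count_transpose)

lemma finite_Hecke: "finite (Hecke n)"
proof (rule finite_subset)
  show "Hecke n \<subseteq> {0..int n} \<times> {0..int n} \<times> {0..int n}"
  proof
    fix h assume "h \<in> Hecke n"
    then obtain a b d where h: "h = (a, b, d)" "a > 0" "d > 0" "a * d = int n" "0 \<le> b" "b < d"
      by (auto simp: Hecke_def)
    then have "a * 1 \<le> a * d" "1 * d \<le> a * d" by (intro mult_mono; simp)+
    then show "h \<in> {0..int n} \<times> {0..int n} \<times> {0..int n}" using h by simp
  qed
qed simp

section \<open>Cosets of the lattice in its dual, in block coordinates\<close>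

lemma bform_lattice_dual:
  assumes "u \<in> lattice_L S" "v \<in> dual_L S"
  shows "bform (Q_mat S) u v \<in> \<int>"
proof -
  obtain a where a: "a \<in> carrier_vec (dim_row S + 4)" "u = map_vec of_int a"
    using assms(1) unfolding lattice_L_def by blast
  obtain l where l: "l \<in> carrier_vec (dim_row S + 4)" "map_mat of_int (Q_mat S) *\<^sub>v v = map_vec of_int l"
    using assms(2) unfolding dual_L_def lattice_L_def by blast
  have "bform (Q_mat S) u v = of_int (a \<bullet> l)"
    unfolding bform_def l(2) a(2) using a(1) l(1) by (simp add: scalar_prod_def)
  then show ?thesis by simp
qed

lemma lattice_L_alt: "lattice_L S = map_vec of_int ` carrier_vec (dim_row S + 2 + 2)"
proof -
  have "dim_row S + 4 = dim_row S + 2 + 2" by simp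
  then show ?thesis unfolding lattice_L_def by (rule arg_cong)
qed

lemma lattice_L_eq:
  "lattice_L S = {triple (of_int a) (triple (of_int b) (map_vec of_int k) (of_int c)) (of_int d) | a b c d k.
     k \<in> carrier_vec (dim_row S)}" (is "_ = ?R")
proof (intro equalityI subsetI)
  fix v assume "v \<in> lattice_L S"
  then obtain u where u: "u \<in> carrier_vec (dim_row S + 2 + 2)" "v = map_vec of_int u"
    unfolding lattice_L_alt by blast
  obtain a u' d where 1: "u = triple a u' d" "u' \<in> carrier_vec (dim_row S + 2)"
    using triple_cases[OF u(1)] by metis
  obtain b k c where 2: "u' = triple b k c" "k \<in> carrier_vec (dim_row S)"
    using triple_cases[OF 1(2)] by metis
  show "v \<in> ?R" using 2(2) unfolding u(2) 1(1) 2(1) map_vec_triple by blast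
next
  fix v assume "v \<in> ?R"
  then obtain a b c d k where k: "k \<in> carrier_vec (dim_row S)"
    "v = map_vec of_int (triple a (triple b k c) d)" unfolding map_vec_triple by blast
  have "triple a (triple b k c) d \<in> carrier_vec (dim_row S + 2 + 2)"
    using k(1) by (simp only: triple_carrier)
  then show "v \<in> lattice_L S" unfolding k(2) lattice_L_alt by (rule imageI)
qed

text \<open>The two hyperbolic planes are unimodular, so a coset is nontrivial only in the \<open>S\<close>-block.\<close>
lemma discriminant_coset:
  assumes S: "S \<in> carrier_mat m m" and \<alpha>: "\<alpha> \<in> discriminant_group S"
  obtains \<beta> where "\<beta> \<in> carrier_vec m"
    "\<alpha> = (\<lambda>((i1, i2, i3, i4), x). triple (of_int i1) (triple (of_int i2) x (of_int i3)) (of_int i4)) `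
      (UNIV \<times> (\<lambda>k. \<beta> + map_vec of_int k) ` carrier_vec m)"
proof -
  have m: "dim_row S = m" using S by simp
  obtain v where v: "v \<in> dual_L S" "\<alpha> = (\<lambda>l. v + l) ` lattice_L S"
    using \<alpha> by (auto simp: discriminant_group_def)
  have "m + 4 = m + 2 + 2" by simp
  then have "v \<in> carrier_vec (m + 2 + 2)" using v(1) m unfolding dual_L_def by (metis (lifting) mem_Collect_eq)
  then obtain a u d where 1: "v = triple a u d" "u \<in> carrier_vec (m + 2)" using triple_cases by metis
  obtain b \<beta> c where 2: "u = triple b \<beta> c" "\<beta> \<in> carrier_vec m" using triple_cases[OF 1(2)] by metis
  have v_eq: "v = triple a (triple b \<beta> c) d" using 1 2 by simp
  have S1: "- S \<in> carrier_mat m m" "hyp_border (- S) \<in> carrier_mat (m + 2) (m + 2)"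
    using S by (auto intro: carrier_matI)
  have carr: "triple p x r \<in> carrier_vec (m + 2)" if "x \<in> carrier_vec m" for p r :: real and x
    using that by (simp only: triple_carrier)
  let ?o = "0\<^sub>v m :: real vec"
  \<comment> \<open>The dual vector is tested against lattice vectors supported on the hyperbolic
    planes; a unit vector there reads off the opposite coordinate of \<open>v\<close>.\<close>
  have int: "p * d + r * a + (q * c + s * b) \<in> \<int>" if Z: "p \<in> \<int>" "q \<in> \<int>" "r \<in> \<int>" "s \<in> \<int>" for p q r s :: real
  proof -
    obtain p' q' r' s' where e: "p = of_int p'" "q = of_int q'" "r = of_int r'" "s = of_int s'"
      using Z unfolding Ints_def by blast
    have "?o = map_vec of_int (0\<^sub>v m)" by (intro eq_vecI) simp_all
    then have "triple p (triple q ?o s) r \<in> lattice_L S"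
      unfolding lattice_L_eq m e by (metis (mono_tags, lifting) mem_Collect_eq zero_carrier_vec)
    from bform_lattice_dual[OF this v(1)]
    have "bform (Q_mat S) (triple p (triple q ?o s) r) (triple a (triple b \<beta> c) d) \<in> \<int>"
      unfolding v_eq .
    moreover have "bform (- S) ?o \<beta> = 0" using S 2(2) by (simp add: bform_expand[where k = m])
    ultimately show ?thesis
      unfolding Q_mat_def Q1_mat_def bform_hyp_border[OF S1(2) carr[OF zero_carrier_vec] carr[OF 2(2)]]
        bform_hyp_border[OF S1(1) zero_carrier_vec 2(2)] by simp
  qed
  obtain a' b' c' d' where e: "a = of_int a'" "b = of_int b'" "c = of_int c'" "d = of_int d'"
  proof -
    have "d \<in> \<int>" "c \<in> \<int>" "a \<in> \<int>" "b \<in> \<int>"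
      using int[of 1 0 0 0] int[of 0 1 0 0] int[of 0 0 1 0] int[of 0 0 0 1] by simp_all
    then show ?thesis using that unfolding Ints_def by blast
  qed
  let ?t = "\<lambda>((i1, i2, i3, i4), x). triple (of_int i1 :: real) (triple (of_int i2) x (of_int i3)) (of_int i4)"
  have add: "v + triple (of_int i1) (triple (of_int i2) (map_vec of_int k) (of_int i3)) (of_int i4) =
      ?t ((a' + i1, b' + i2, c' + i3, d' + i4), \<beta> + map_vec of_int k)"
    if "k \<in> carrier_vec m" for i1 i2 i3 i4 k
  proof -
    have k: "map_vec real_of_int k \<in> carrier_vec m" using that by simp
    show ?thesis
      unfolding v_eq e using triple_add[OF carr[OF 2(2)] carr[OF k]] triple_add[OF 2(2) k] by simp
  qed
  have "\<alpha> = ?t ` (UNIV \<times> (\<lambda>k. \<beta> + map_vec of_int k) ` carrier_vec m)"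
  proof (intro equalityI subsetI)
    fix y assume "y \<in> \<alpha>"
    then obtain i1 i2 i3 i4 k where k: "k \<in> carrier_vec m"
      and y: "y = v + triple (of_int i1) (triple (of_int i2) (map_vec of_int k) (of_int i3)) (of_int i4)"
      unfolding v(2) lattice_L_eq m by blast
    show "y \<in> ?t ` (UNIV \<times> (\<lambda>k. \<beta> + map_vec of_int k) ` carrier_vec m)"
      unfolding y add[OF k] using k by (intro imageI) simp
  next
    fix y assume "y \<in> ?t ` (UNIV \<times> (\<lambda>k. \<beta> + map_vec of_int k) ` carrier_vec m)"
    then obtain i1 i2 i3 i4 k where k: "k \<in> carrier_vec m"
      and y: "y = ?t ((i1, i2, i3, i4), \<beta> + map_vec of_int k)" by auto
    have "y = v + triple (of_int (i1 - a')) (triple (of_int (i2 - b')) (map_vec of_int k) (of_int (i3 - c'))) (of_int (i4 - d'))"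
      unfolding y add[OF k] by simp
    then show "y \<in> \<alpha>" unfolding v(2) lattice_L_eq m using k by blast
  qed
  then show ?thesis using that 2(2) by blast
qed

section \<open>The summand of the theta series and its transformation\<close>

definition theta_term ::
  "int mat \<Rightarrow> complex \<Rightarrow> complex \<Rightarrow> complex vec \<Rightarrow> complex \<Rightarrow> real \<Rightarrow> real \<Rightarrow> real \<Rightarrow> real \<Rightarrow> real vec \<Rightarrow> complex" where
  "theta_term S \<tau> z w z' x1 x2 x3 x4 x =
     e2pi (\<i> * of_real (Im \<tau> * (cmod (lift_pairing S z w z' x1 x2 x3 x4 x))\<^sup>2 / lift_norm S z w z')
        + cnj \<tau> / 2 * of_real (2 * x1 * x4 + 2 * x2 * x3 - qform S x))"

text \<open>The conjugate in \<open>cnj \<tau>\<close> gives the indefinite form a negative sign in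
  the imaginary part of the exponent, which is therefore Im \<tau> times the majorant.\<close>

lemma norm_theta_term:
  "norm (theta_term S \<tau> z w z' x1 x2 x3 x4 x) = exp (- 2 * pi * Im \<tau> * majorant S z w z' x1 x2 x3 x4 x)"
  by (simp add: theta_term_def e2pi_def majorant_def algebra_simps diff_divide_distrib)

lemma Theta_eq:
  assumes S: "S \<in> carrier_mat m m" and w: "w \<in> carrier_vec m" and B: "B \<subseteq> carrier_vec m"
    and \<alpha>: "\<alpha> = (\<lambda>((i1, i2, i3, i4), x). triple (of_int i1) (triple (of_int i2) x (of_int i3)) (of_int i4)) `
      (UNIV \<times> B)"
  shows "Theta S \<alpha> \<tau> (triple z w z') = (\<Sum>\<^sub>\<infinity>((i1, i2, i3, i4), x)\<in>UNIV \<times> B.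
    theta_term S \<tau> z w z' (of_int i1) (of_int i2) (of_int i3) (of_int i4) x)"
proof -
  let ?t = "\<lambda>((i1, i2, i3, i4), x). triple (of_int i1 :: real) (triple (of_int i2) x (of_int i3)) (of_int i4)"
  have "inj_on ?t (UNIV \<times> B)"
  proof (rule inj_onI)
    fix p r
    assume mem: "p \<in> UNIV \<times> B" "r \<in> UNIV \<times> B" and t: "?t p = ?t r"
    obtain i1 i2 i3 i4 x j1 j2 j3 j4 y where pr: "p = ((i1, i2, i3, i4), x)" "r = ((j1, j2, j3, j4), y)"
      by (metis surj_pair)
    have x: "x \<in> B" and y: "y \<in> B" and eq: "?t ((i1, i2, i3, i4), x) = ?t ((j1, j2, j3, j4), y)"
      using mem t by (simp_all only: pr mem_Sigma_iff)
    have "triple p u r \<in> carrier_vec (m + 2)" if "u \<in> B" for p r :: real and u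
      using that B unfolding triple_carrier by blast
    note outer = triple_eq_iff[OF this[OF x] this[OF y]]
    have "x \<in> carrier_vec m" "y \<in> carrier_vec m" using x y B by auto
    note inner = triple_eq_iff[OF this]
    show "p = r" using eq by (simp add: pr outer inner)
  qed
  then have "Theta S \<alpha> \<tau> (triple z w z') = infsum ((\<lambda>l.
     e2pi (\<i> * of_real (Im \<tau> * (cmod (bform (Q_mat S) (map_vec of_real l) (Z_lift S (triple z w z'))))\<^sup>2
                         / qform (Q1_mat S) (map_vec Im (triple z w z')))
        + cnj \<tau> / 2 * of_real (qform (Q_mat S) l))) \<circ> ?t) (UNIV \<times> B)"
    unfolding Theta_def \<alpha> by (rule infsum_reindex)
  also have "\<dots> = (\<Sum>\<^sub>\<infinity>((i1, i2, i3, i4), x)\<in>UNIV \<times> B.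
    theta_term S \<tau> z w z' (of_int i1) (of_int i2) (of_int i3) (of_int i4) x)"
  proof (rule infsum_cong, clarify)
    fix i1 i2 i3 i4 x assume "x \<in> B"
    then have x: "x \<in> carrier_vec m" using B by blast
    have cx: "map_vec complex_of_real x \<in> carrier_vec m" and iw: "map_vec Im w \<in> carrier_vec m"
      using x w by simp_all
    show "((\<lambda>l. e2pi (\<i> * of_real (Im \<tau> * (cmod (bform (Q_mat S) (map_vec of_real l) (Z_lift S (triple z w z'))))\<^sup>2
                         / qform (Q1_mat S) (map_vec Im (triple z w z')))
        + cnj \<tau> / 2 * of_real (qform (Q_mat S) l))) \<circ> ?t) ((i1, i2, i3, i4), x)
      = theta_term S \<tau> z w z' (of_int i1) (of_int i2) (of_int i3) (of_int i4) x"
      unfolding o_def prod.case map_vec_triple bform_Z_lift[OF S cx w] qform_Q1[OF S iw] qform_Q[OF S x]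
        theta_term_def lift_pairing_def lift_norm_def by simp
  qed
  finally show ?thesis .
qed

text \<open>The pairing is multiplied by sqrt n / d, so its squared modulus scales by n / d^2 = a /
  d, exactly as \<open>lift_norm\<close> does. The integral map scales the hyperbolic part of the
  form by a * d = n, which the two divisions by sqrt n cancel; the S-block is untouched.\<close>

lemma theta_term_transform:
  assumes S: "S \<in> carrier_mat m m" and w: "w \<in> carrier_vec m" and x: "x \<in> carrier_vec m"
    and n: "n > 0" and h: "(a, b, d) \<in> Hecke n"
  shows "theta_term S \<tau> ((of_int a * z + of_int b) / of_int d) (of_real (sqrt (real n) / of_int d) \<cdot>\<^sub>v w) z'
      x1 x2 x3 x4 x =
    theta_term S \<tau> z w z' ((d * x1 + b * x3) / sqrt n) ((d * x2 - b * x4) / sqrt n)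
      (a * x3 / sqrt n) (a * x4 / sqrt n) x" (is ?left)
    and "theta_term S \<tau> z (of_real (sqrt (real n) / of_int d) \<cdot>\<^sub>v w) ((of_int a * z' + of_int b) / of_int d)
      x1 x2 x3 x4 x =
    theta_term S \<tau> z w z' ((d * x1 + b * x2) / sqrt n) (a * x2 / sqrt n)
      ((d * x3 - b * x4) / sqrt n) (a * x4 / sqrt n) x" (is ?right)
proof -
  let ?n = "sqrt (real n)"
  let ?w = "of_real (?n / of_int d) \<cdot>\<^sub>v w"
  have ad: "real_of_int a * real_of_int d = real n" and d: "real_of_int d \<noteq> 0" and a: "real_of_int a \<noteq> 0"
    using h by (auto simp: Hecke_def simp flip: of_int_mult)
  have n0: "?n \<noteq> 0" using n by simp
  have nn: "?n * ?n = real_of_int a * real_of_int d" using ad by simp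
  then have nc: "complex_of_real ?n * complex_of_real ?n = of_int a * of_int d"
    by (metis of_real_mult of_real_of_int_eq)
  have dc: "complex_of_int d \<noteq> 0" and nc0: "complex_of_real ?n \<noteq> 0" using d n0 by auto
  have cx: "map_vec complex_of_real x \<in> carrier_vec m" using x by simp
  have bw: "bform S (map_vec complex_of_real x) ?w =
      of_real ?n / of_int d * bform S (map_vec complex_of_real x) w"
    using bform_smult_right[OF S w cx] by simp
  have qw: "qform S ?w = of_int a / of_int d * qform S w"
    using qform_smult[OF S w, of "of_real (?n / of_int d)"] nc dc
    by (simp add: power2_eq_square field_simps)
  have nw: "qform S (map_vec Im ?w) = a / d * qform S (map_vec Im w)"
    unfolding Im_qform_smult[OF S w] using nn d by (simp add: power2_eq_square field_simps)
  have ratio: "Im \<tau> * (cmod (of_real ?n / of_int d * A))\<^sup>2 / (a / d * N) = Im \<tau> * (cmod A)\<^sup>2 / N" for A N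
  proof -
    have "(cmod (of_real ?n / of_int d * A))\<^sup>2 = a / d * (cmod A)\<^sup>2"
      using nn d by (simp add: norm_mult norm_divide power_mult_distrib power_divide power2_eq_square field_simps)
    then show ?thesis using a d by simp
  qed
  have quot: "2 * (A / N) * (B / N) + 2 * (C / N) * (D / N) = (2 * A * B + 2 * C * D) / (N * N)"
    for A B C D N :: real by (simp add: add_divide_distrib)
  have im: "Im ((of_int a * u + of_int b) / of_int d) = a / d * Im u" for u
    using Im_divide_of_real[of "of_int a * u + of_int b" "of_int d"] by simp
  have "lift_norm S ((of_int a * z + of_int b) / of_int d) ?w z' = a / d * lift_norm S z w z'"
    unfolding lift_norm_def nw im by (simp add: algebra_simps)
  moreover have "lift_pairing S ((of_int a * z + of_int b) / of_int d) ?w z' x1 x2 x3 x4 x =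
    of_real ?n / of_int d * lift_pairing S z w z' ((d * x1 + b * x3) / ?n) ((d * x2 - b * x4) / ?n)
      (a * x3 / ?n) (a * x4 / ?n) x"
    unfolding lift_pairing_def bw qw using dc nc0 by (simp add: field_simps)
  moreover have "2 * ((d * x1 + b * x3) / ?n) * (a * x4 / ?n) + 2 * ((d * x2 - b * x4) / ?n) * (a * x3 / ?n)
      = 2 * x1 * x4 + 2 * x2 * x3"
  proof -
    have "2 * ((d * x1 + b * x3) / ?n) * (a * x4 / ?n) + 2 * ((d * x2 - b * x4) / ?n) * (a * x3 / ?n)
      = (a * d) * (2 * x1 * x4 + 2 * x2 * x3) / (?n * ?n)"
      unfolding quot by (simp add: algebra_simps)
    then show ?thesis using nn a d by simp
  qed
  ultimately show ?left by (simp only: theta_term_def ratio)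
  have "lift_norm S z ?w ((of_int a * z' + of_int b) / of_int d) = a / d * lift_norm S z w z'"
    unfolding lift_norm_def nw im by (simp add: algebra_simps)
  moreover have "lift_pairing S z ?w ((of_int a * z' + of_int b) / of_int d) x1 x2 x3 x4 x =
    of_real ?n / of_int d * lift_pairing S z w z' ((d * x1 + b * x2) / ?n) (a * x2 / ?n)
      ((d * x3 - b * x4) / ?n) (a * x4 / ?n) x"
    unfolding lift_pairing_def bw qw using dc nc0 by (simp add: field_simps)
  moreover have "2 * ((d * x1 + b * x2) / ?n) * (a * x4 / ?n) + 2 * (a * x2 / ?n) * ((d * x3 - b * x4) / ?n)
      = 2 * x1 * x4 + 2 * x2 * x3"
  proof -
    have "2 * ((d * x1 + b * x2) / ?n) * (a * x4 / ?n) + 2 * (a * x2 / ?n) * ((d * x3 - b * x4) / ?n)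
      = (a * d) * (2 * x1 * x4 + 2 * x2 * x3) / (?n * ?n)"
      unfolding quot by (simp add: algebra_simps)
    then show ?thesis using nn a d by simp
  qed
  ultimately show ?right by (simp only: theta_term_def ratio)
qed

text \<open>By coercivity the norm of each term is at most a constant times a product of Gaussians:
  rate \<open>C / n\<close> in the scaled outer coordinates, and \<open>C / 2\<close> in the
  S-block, where half the rate is spent on absorbing the shift by \<beta>.\<close>

lemma (in theta_point) theta_term_summable:
  assumes \<tau>: "Im \<tau> > 0" and \<beta>: "\<beta> \<in> carrier_vec m" and n: "n > (0::real)"
  shows "(\<lambda>((y1, y2, y3, y4), x). theta_term S \<tau> z w z' (of_int y1 / sqrt n) (of_int y2 / sqrt n)
      (of_int y3 / sqrt n) (of_int y4 / sqrt n) x)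
    summable_on (UNIV \<times> (\<lambda>k. \<beta> + map_vec of_int k) ` carrier_vec m)"
    (is "?F summable_on UNIV \<times> ?s ` _")
proof -
  obtain c where c: "c > 0" "\<And>x1 x2 x3 x4 x. x \<in> carrier_vec m \<Longrightarrow>
      c * (x1\<^sup>2 + x2\<^sup>2 + x3\<^sup>2 + x4\<^sup>2 + (\<Sum>j<m. (x $ j)\<^sup>2)) \<le> majorant S z w z' x1 x2 x3 x4 x"
    using majorant_coercive by blast
  define C where "C = 2 * pi * Im \<tau> * c"
  have C: "C > 0" using c \<tau> by (simp add: C_def)
  let ?e = "\<lambda>y :: int. exp (- (C / n) * (of_int y)\<^sup>2)"
  let ?g = "\<lambda>k :: int vec. exp (- (C / 2) * (\<Sum>j<m. (of_int (k $ j))\<^sup>2))"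
  let ?K = "exp (C * (\<Sum>j<m. (\<beta> $ j)\<^sup>2))"
  let ?G = "\<lambda>((y1, y2, y3, y4), k). (?e y1 * (?e y2 * (?e y3 * ?e y4))) * ?g k"
  have e: "?e summable_on UNIV" using C n by (intro gaussian_summable_int) simp
  have "(\<lambda>(y3, y4). ?e y3 * ?e y4) summable_on UNIV \<times> UNIV"
    using e e by (rule summable_on_Times_nonneg) simp_all
  with e have "(\<lambda>(y2, p). ?e y2 * (\<lambda>(y3, y4). ?e y3 * ?e y4) p) summable_on UNIV \<times> (UNIV \<times> UNIV)"
    by (rule summable_on_Times_nonneg) auto
  with e have "(\<lambda>(y1, t). ?e y1 * (\<lambda>(y2, p). ?e y2 * (\<lambda>(y3, y4). ?e y3 * ?e y4) p) t)
      summable_on UNIV \<times> (UNIV \<times> (UNIV \<times> UNIV))"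
    by (rule summable_on_Times_nonneg) auto
  moreover have "?g summable_on carrier_vec m" using C by (intro gaussian_summable_int_vec) simp
  ultimately have "(\<lambda>(q, k). (\<lambda>(y1, t). ?e y1 * (\<lambda>(y2, p). ?e y2 * (\<lambda>(y3, y4). ?e y3 * ?e y4) p) t) q * ?g k)
      summable_on (UNIV \<times> (UNIV \<times> (UNIV \<times> UNIV))) \<times> carrier_vec m"
    by (rule summable_on_Times_nonneg) auto
  then have G: "(\<lambda>p. ?K * ?G p) summable_on UNIV \<times> carrier_vec m"
    by (intro summable_on_cmult_right) (simp add: case_prod_unfold)
  let ?m = "\<lambda>(y :: int \<times> int \<times> int \<times> int, k). (y, ?s k)"
  have img: "UNIV \<times> ?s ` carrier_vec m = ?m ` (UNIV \<times> carrier_vec m)" by auto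
  have inj: "inj_on ?m (UNIV \<times> carrier_vec m)"
  proof (rule inj_onI)
    fix p r :: "(int \<times> int \<times> int \<times> int) \<times> int vec"
    assume mem: "p \<in> UNIV \<times> carrier_vec m" "r \<in> UNIV \<times> carrier_vec m" and "?m p = ?m r"
    moreover obtain y k y' l where pr: "p = (y, k)" "r = (y', l)" by (metis surj_pair)
    ultimately have k: "k \<in> carrier_vec m" "l \<in> carrier_vec m" and y: "y = y'" and eq: "?s k = ?s l"
      by simp_all
    have "k = l"
    proof (rule eq_vecI)
      fix i assume i: "i < dim_vec l"
      then have "?s k $ i = ?s l $ i" using eq by simp
      then show "k $ i = l $ i" using i k \<beta> by simp
    qed (use k in simp)
    then show "p = r" using pr y by simp
  qed
  have "(\<lambda>p. norm ((?F \<circ> ?m) p)) summable_on UNIV \<times> carrier_vec m"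
  proof (rule summable_on_comparison_test[OF G])
    fix p assume "p \<in> (UNIV :: (int \<times> int \<times> int \<times> int) set) \<times> (carrier_vec m :: int vec set)"
    moreover obtain y1 y2 y3 y4 k where p: "p = ((y1, y2, y3, y4), k)" by (metis surj_pair)
    ultimately have k: "k \<in> carrier_vec m" by simp
    let ?y = "\<lambda>y. of_int y / sqrt n"
    let ?x = "?s k"
    have x: "?x \<in> carrier_vec m" using k \<beta> by simp
    \<comment> \<open>Coordinatewise, (\<beta> + k)^2 - k^2 / 2 + \<beta>^2 is half the square of 2
      \<beta> + k. The constant in \<beta> goes into \<open>?K\<close>.\<close>
    have sq: "(\<Sum>j<m. (of_int (k $ j))\<^sup>2) / 2 - (\<Sum>j<m. (\<beta> $ j)\<^sup>2) \<le> (\<Sum>j<m. (?x $ j)\<^sup>2)"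
      unfolding sum_divide_distrib sum_subtractf[symmetric]
    proof (rule sum_mono)
      fix j assume "j \<in> {..<m}"
      then have j: "?x $ j = \<beta> $ j + of_int (k $ j)" using k \<beta> by simp
      show "(of_int (k $ j))\<^sup>2 / 2 - (\<beta> $ j)\<^sup>2 \<le> (?x $ j)\<^sup>2"
        unfolding j using zero_le_power2[of "2 * \<beta> $ j + of_int (k $ j)"]
        by (simp add: power2_eq_square algebra_simps)
    qed
    have "C * ((?y y1)\<^sup>2 + (?y y2)\<^sup>2 + (?y y3)\<^sup>2 + (?y y4)\<^sup>2 + (\<Sum>j<m. (?x $ j)\<^sup>2))
        \<le> 2 * pi * Im \<tau> * majorant S z w z' (?y y1) (?y y2) (?y y3) (?y y4) ?x"
      unfolding C_def mult.assoc[of "2 * pi * Im \<tau>"]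
      using c(2)[OF x, of "?y y1" "?y y2" "?y y3" "?y y4"] \<tau> by (intro mult_left_mono) simp_all
    moreover have "C * ((\<Sum>j<m. (of_int (k $ j))\<^sup>2) / 2 - (\<Sum>j<m. (\<beta> $ j)\<^sup>2)) \<le> C * (\<Sum>j<m. (?x $ j)\<^sup>2)"
      using sq C by (intro mult_left_mono) simp_all
    moreover have "(?y y)\<^sup>2 = (of_int y)\<^sup>2 / n" for y using n by (simp add: power_divide)
    ultimately have "- 2 * pi * Im \<tau> * majorant S z w z' (?y y1) (?y y2) (?y y3) (?y y4) ?x \<le>
        C * (\<Sum>j<m. (\<beta> $ j)\<^sup>2) + ((- (C / n) * (of_int y1)\<^sup>2 + (- (C / n) * (of_int y2)\<^sup>2
        + (- (C / n) * (of_int y3)\<^sup>2 + - (C / n) * (of_int y4)\<^sup>2))) + - (C / 2) * (\<Sum>j<m. (of_int (k $ j))\<^sup>2))"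
      by (simp add: algebra_simps)
    then have "norm (?F ((y1, y2, y3, y4), ?x)) \<le> ?K * ?G ((y1, y2, y3, y4), k)"
      unfolding prod.case norm_theta_term exp_add[symmetric] exp_le_cancel_iff .
    then show "norm ((?F \<circ> ?m) p) \<le> ?K * ?G p"
      unfolding p o_def prod.case .
  qed simp
  then have "(?F \<circ> ?m) summable_on UNIV \<times> carrier_vec m" by (rule abs_summable_summable)
  then show ?thesis unfolding img summable_on_reindex[OF inj] .
qed

theorem theorem3p1:
  fixes m n :: nat and S :: "int mat" and \<alpha> :: "real vec set"
    and \<tau> z z' :: complex and w :: "complex vec"
  assumes "S \<in> carrier_mat m m" and "transpose_mat S = S"
    and "positive_definite S" and "even_form S"
    and "\<alpha> \<in> discriminant_group S"
    and "Im \<tau> > 0"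
    and "w \<in> carrier_vec m" and "triple z w z' \<in> domain_D S"
  shows "(\<Sum>(a, b, d)\<in>Hecke n.
            Theta S \<alpha> \<tau> (triple ((of_int a * z + of_int b) / of_int d)
                                (of_real (sqrt (real n) / of_int d) \<cdot>\<^sub>v w) z'))
       = (\<Sum>(a, b, d)\<in>Hecke n.
            Theta S \<alpha> \<tau> (triple z
                                (of_real (sqrt (real n) / of_int d) \<cdot>\<^sub>v w)
                                ((of_int a * z' + of_int b) / of_int d)))"
\<comment> \<open>For n = 0 both sums are empty; otherwise division by sqrt n is legitimate.\<close>
proof (cases "n = 0")
  case True
  then have "Hecke n = {}" by (auto simp: Hecke_def)
  then show ?thesis by simp
next
  case False
  then have n: "n > 0" by simp
  note Sc = assms(1) and wc = assms(7)
  \<comment> \<open>Membership in \<open>domain_D\<close> yields some representation of the point;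
    injectivity of \<open>triple\<close> identifies its entries with the given ones.\<close>
  obtain z1 w1 z1' where Z: "triple z w z' = triple z1 w1 z1'" "w1 \<in> carrier_vec m" "Im z1' > 0"
    "qform (Q1_mat S) (map_vec Im (triple z1 w1 z1')) > 0"
    using assms(8) Sc by (auto simp: domain_D_def)
  have eqs: "z1 = z" "w1 = w" "z1' = z'" using Z(1) triple_eq_iff[OF wc Z(2)] by auto
  have "map_vec Im w \<in> carrier_vec m" using wc by simp
  then have "lift_norm S z w z' > 0"
    using Z(4) qform_Q1[OF Sc, of "map_vec Im w" "Im z" "Im z'"]
    by (simp add: eqs lift_norm_def map_vec_triple)
  then interpret theta_point m S z z' w
    using Z(3) assms(1-3,7) by unfold_locales (simp_all add: eqs)
  obtain \<beta> where \<beta>: "\<beta> \<in> carrier_vec m"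
    and \<alpha>: "\<alpha> = (\<lambda>((i1, i2, i3, i4), x). triple (of_int i1) (triple (of_int i2) x (of_int i3)) (of_int i4)) `
      (UNIV \<times> (\<lambda>k. \<beta> + map_vec of_int k) ` carrier_vec m)"
    using discriminant_coset[OF Sc assms(5)] .
  let ?B = "(\<lambda>k. \<beta> + map_vec of_int k) ` carrier_vec m"
  have B: "?B \<subseteq> carrier_vec m" using \<beta> by auto
  \<comment> \<open>One function for both sides and all Hecke triples: the dependence on (a, b, d)
    sits entirely in the integral maps applied to y.\<close>
  define F where "F = (\<lambda>((y1, y2, y3, y4), x). theta_term S \<tau> z w z' (of_int y1 / sqrt n) (of_int y2 / sqrt n)
      (of_int y3 / sqrt n) (of_int y4 / sqrt n) x)"
  have F: "F summable_on UNIV \<times> ?B"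
    unfolding F_def using assms(6) \<beta> n by (intro theta_term_summable) simp_all
  have sw: "c \<cdot>\<^sub>v w \<in> carrier_vec m" for c using wc by simp
  have left: "Theta S \<alpha> \<tau> (triple ((of_int a * z + of_int b) / of_int d)
        (of_real (sqrt (real n) / of_int d) \<cdot>\<^sub>v w) z')
      = (\<Sum>\<^sub>\<infinity>(y, x)\<in>UNIV \<times> ?B. F (left_map (a, b, d) y, x))" if h: "(a, b, d) \<in> Hecke n" for a b d
    unfolding Theta_eq[OF Sc sw B \<alpha>]
  proof (rule infsum_cong, clarify)
    fix i1 i2 i3 i4 and k :: "int vec" assume "k \<in> carrier_vec m"
    then have x: "\<beta> + map_vec of_int k \<in> carrier_vec m" using \<beta> by simp
    show "theta_term S \<tau> ((of_int a * z + of_int b) / of_int d) (of_real (sqrt (real n) / of_int d) \<cdot>\<^sub>v w) z'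
        (of_int i1) (of_int i2) (of_int i3) (of_int i4) (\<beta> + map_vec of_int k)
      = F (left_map (a, b, d) (i1, i2, i3, i4), \<beta> + map_vec of_int k)"
      unfolding theta_term_transform(1)[OF Sc wc x n h] by (simp add: F_def left_map_def)
  qed
  have right: "Theta S \<alpha> \<tau> (triple z (of_real (sqrt (real n) / of_int d) \<cdot>\<^sub>v w)
        ((of_int a * z' + of_int b) / of_int d))
      = (\<Sum>\<^sub>\<infinity>(y, x)\<in>UNIV \<times> ?B. F (right_map (a, b, d) y, x))" if h: "(a, b, d) \<in> Hecke n" for a b d
    unfolding Theta_eq[OF Sc sw B \<alpha>]
  proof (rule infsum_cong, clarify)
    fix i1 i2 i3 i4 and k :: "int vec" assume "k \<in> carrier_vec m"
    then have x: "\<beta> + map_vec of_int k \<in> carrier_vec m" using \<beta> by simp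
    show "theta_term S \<tau> z (of_real (sqrt (real n) / of_int d) \<cdot>\<^sub>v w) ((of_int a * z' + of_int b) / of_int d)
        (of_int i1) (of_int i2) (of_int i3) (of_int i4) (\<beta> + map_vec of_int k)
      = F (right_map (a, b, d) (i1, i2, i3, i4), \<beta> + map_vec of_int k)"
      unfolding theta_term_transform(2)[OF Sc wc x n h] by (simp add: F_def right_map_def)
  qed
  have "(\<Sum>(a, b, d)\<in>Hecke n. Theta S \<alpha> \<tau> (triple ((of_int a * z + of_int b) / of_int d)
        (of_real (sqrt (real n) / of_int d) \<cdot>\<^sub>v w) z'))
      = (\<Sum>h\<in>Hecke n. \<Sum>\<^sub>\<infinity>(y, x)\<in>UNIV \<times> ?B. F (left_map h y, x))"
    by (rule sum.cong) (auto simp only: left)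
  also have "\<dots> = (\<Sum>\<^sub>\<infinity>(y, x)\<in>UNIV \<times> ?B. of_nat (card {h \<in> Hecke n. y \<in> range (left_map h)}) * F (y, x))"
    by (rule sum_infsum_reindex[OF finite_Hecke _ F]) (rule inj_left_map)
  \<comment> \<open>Here the two sides meet: the weights agree at every y.\<close>
  also have "\<dots> = (\<Sum>\<^sub>\<infinity>(y, x)\<in>UNIV \<times> ?B. of_nat (card {h \<in> Hecke n. y \<in> range (right_map h)}) * F (y, x))"
    unfolding card_left_eq_right ..
  also have "\<dots> = (\<Sum>h\<in>Hecke n. \<Sum>\<^sub>\<infinity>(y, x)\<in>UNIV \<times> ?B. F (right_map h y, x))"
    by (rule sum_infsum_reindex[OF finite_Hecke _ F, symmetric]) (rule inj_right_map)
  also have "\<dots> = (\<Sum>(a, b, d)\<in>Hecke n. Theta S \<alpha> \<tau> (triple z (of_real (sqrt (real n) / of_int d) \<cdot>\<^sub>v w)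
        ((of_int a * z' + of_int b) / of_int d)))"
    by (rule sum.cong) (auto simp only: right)
  finally show ?thesis .
qed

end
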